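(* Let $q=2^e$ with $e>1$, and let $q_0$ be such that $q=q_0^r$ for a prime $r$. Then the subfield subgroup $\mathrm{Sp}_4(q_0)\le\mathrm{Sp}_4(q)$ is not a strong Gelfand subgroup, i.e. $(\mathrm{Sp}_4(q),\mathrm{Sp}_4(q_0))$ is not a strong Gelfand pair.
   Context: All characters are complex. A pair $(G,H)$ with $H\le G$ finite is a strong Gelfand pair (and $H$ a strong Gelfand subgroup) if for every irreducible character $\psi$ of $H$, the induced character $\psi\uparrow G$ satisfies $\langle \psi\uparrow G,\chi\rangle\le 1$ for every irreducible character $\chi$ of $G$. $\mathrm{Sp}_4(q)$ is the symplectic group of a nondegenerate alternating form on $\mathbb{F}_q^4$, and $\mathrm{Sp}_4(q_0)$ is the subgroup of its elements with all matrix entries (in a symplectic basis) in the subfield $\mathbb{F}_{q_0}$. *)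

theory Defs
  imports "Jordan_Normal_Form.Matrix" "HOL-Algebra.Group" "HOL-Computational_Algebra.Primes"
begin

definition mat_trace :: "'b :: comm_monoid_add mat \<Rightarrow> 'b" where
  "mat_trace A = (\<Sum>i<dim_row A. A $$ (i, i))"

definition is_rep :: "('g, 'm) monoid_scheme \<Rightarrow> nat \<Rightarrow> ('g \<Rightarrow> complex mat) \<Rightarrow> bool" where
  "is_rep G n \<rho> \<longleftrightarrow>
     (\<forall>g\<in>carrier G. \<rho> g \<in> carrier_mat n n) \<and>
     \<rho> \<one>\<^bsub>G\<^esub> = 1\<^sub>m n \<and>
     (\<forall>g\<in>carrier G. \<forall>h\<in>carrier G. \<rho> (g \<otimes>\<^bsub>G\<^esub> h) = \<rho> g * \<rho> h)"

definition invariant_subspace ::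
  "('g, 'm) monoid_scheme \<Rightarrow> nat \<Rightarrow> ('g \<Rightarrow> complex mat) \<Rightarrow> complex vec set \<Rightarrow> bool" where
  "invariant_subspace G n \<rho> W \<longleftrightarrow>
     W \<subseteq> carrier_vec n \<and> 0\<^sub>v n \<in> W \<and>
     (\<forall>v\<in>W. \<forall>w\<in>W. v + w \<in> W) \<and>
     (\<forall>c. \<forall>v\<in>W. c \<cdot>\<^sub>v v \<in> W) \<and>
     (\<forall>g\<in>carrier G. \<forall>w\<in>W. \<rho> g *\<^sub>v w \<in> W)"

definition is_irrep :: "('g, 'm) monoid_scheme \<Rightarrow> nat \<Rightarrow> ('g \<Rightarrow> complex mat) \<Rightarrow> bool" where
  "is_irrep G n \<rho> \<longleftrightarrow> is_rep G n \<rho> \<and> n > 0 \<and>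
     \<not> (\<exists>W. invariant_subspace G n \<rho> W \<and> W \<noteq> {0\<^sub>v n} \<and> W \<noteq> carrier_vec n)"

definition irr_chars :: "('g, 'm) monoid_scheme \<Rightarrow> ('g \<Rightarrow> complex) set" where
  "irr_chars G = {\<chi>. \<exists>n \<rho>. is_irrep G n \<rho> \<and>
       \<chi> = (\<lambda>g. if g \<in> carrier G then mat_trace (\<rho> g) else 0)}"

definition char_inner :: "('g, 'm) monoid_scheme \<Rightarrow> ('g \<Rightarrow> complex) \<Rightarrow> ('g \<Rightarrow> complex) \<Rightarrow> complex" where
  "char_inner G \<phi> \<psi> = (\<Sum>g\<in>carrier G. \<phi> g * cnj (\<psi> g)) / of_nat (card (carrier G))"

definition induce :: "('g, 'm) monoid_scheme \<Rightarrow> 'g set \<Rightarrow> ('g \<Rightarrow> complex) \<Rightarrow> ('g \<Rightarrow> complex)" where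
  "induce G H \<psi> = (\<lambda>g. if g \<in> carrier G then
      (\<Sum>x\<in>carrier G. (let y = inv\<^bsub>G\<^esub> x \<otimes>\<^bsub>G\<^esub> g \<otimes>\<^bsub>G\<^esub> x in if y \<in> H then \<psi> y else 0))
        / of_nat (card H)
      else 0)"

text \<open>(G,H) is a strong Gelfand pair.  The inner products are nonnegative integers,
  in particular real, so comparing real parts with 1 is the literal condition.\<close>
definition strong_gelfand_pair :: "('g, 'm) monoid_scheme \<Rightarrow> 'g set \<Rightarrow> bool" where
  "strong_gelfand_pair G H \<longleftrightarrow>
     (\<forall>\<psi>\<in>irr_chars (G\<lparr>carrier := H\<rparr>). \<forall>\<chi>\<in>irr_chars G.
        Re (char_inner G (induce G H \<psi>) \<chi>) \<le> 1)"

definition is_subfield :: "'a :: field set \<Rightarrow> bool" where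
  "is_subfield F \<longleftrightarrow> 0 \<in> F \<and> 1 \<in> F \<and>
     (\<forall>x\<in>F. \<forall>y\<in>F. x + y \<in> F \<and> x - y \<in> F \<and> x * y \<in> F) \<and>
     (\<forall>x\<in>F. inverse x \<in> F)"

text \<open>Gram matrix of the standard alternating form on F^4 in the symplectic
  basis (e1,e2,f1,f2) (0-based indices: pairs (0,2) and (1,3)).\<close>
definition J4 :: "'a :: comm_ring_1 mat" where
  "J4 = mat 4 4 (\<lambda>(i, j). if j = i + 2 then 1 else if i = j + 2 then - 1 else 0)"

definition Sp4_set :: "'a :: comm_ring_1 mat set" where
  "Sp4_set = {M \<in> carrier_mat 4 4. transpose_mat M * J4 * M = J4}"

definition Sp4 :: "'a :: comm_ring_1 itself \<Rightarrow> 'a mat monoid" where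
  "Sp4 _ = \<lparr>carrier = Sp4_set, mult = (*), one = 1\<^sub>m 4\<rparr>"

definition Sp4_sub :: "'a :: comm_ring_1 set \<Rightarrow> 'a mat set" where
  "Sp4_sub F0 = {M \<in> Sp4_set. \<forall>i<4. \<forall>j<4. M $$ (i, j) \<in> F0}"

end

theory Submission
  imports Defs "Jordan_Normal_Form.Determinant"
begin

text \<open>
  A strong Gelfand pair $(G,H)$ forces the algebra of $H$-conjugation invariant elements of
  $\mathbb{C}[G]$ to be commutative: if the sums over the $H$-classes of $g$ and $k$ did not
  commute, they would act by noncommuting matrices in some irreducible constituent $\tau$ of the
  regular representation of $G$; both matrices commute with $\tau(H)$, so some irreducible
  representation of $H$ occurs at least twice in the restriction of $\tau$, and Frobenius
  reciprocity gives a multiplicity $\ge 2$.  In particular every product $gk$ is of the form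
  $(xkx^{-1})(ygy^{-1})$ with $x,y\in H$.

  For $\mathrm{Sp}_4$ this fails whenever the subfield is proper.  Pick $\gamma$ outside the
  subfield and let $k$ be the transvection along $e_1$ with coefficient $\gamma$ and $g$ the
  transvection along $w=f_1+\gamma e_2$.  Comparing fixed vectors shows that $xe_1=ae_1$ with
  $a\neq 0$ in the subfield, and then that $yw=\pm(w+\gamma a^2e_1)$.  Splitting over the subfield
  gives $yf_1=\pm f_1$ and $ye_2=\pm(e_2+a^2e_1)$; but $f_1\perp e_2$, whereas $f_1$ is not
  orthogonal to $e_2+a^2e_1$.
\<close>

section \<open>Complex matrices and isometries\<close>

text \<open>The factorisation to be refuted dictates the two transvections. It exists trivially when
  g and k commute, when g lies in H, as (gkg^-1)g, and when k lies in H, as k(k^-1 gk). So both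
  elements must involve \<gamma>, and e_1 and w must not be orthogonal, which is the role of the
  summand f_1 of w. The coefficient \<gamma> of k moves the correction a^2 e_1 into the
  \<gamma>-part of the equation, hence onto ye_2; added to yf_1 instead, it would be compatible with
  the form.

  On the representation side everything is cut out of the regular representation. Its permutation
  matrices are unitary, and compression along an isometry to an invariant subspace keeps them so:
  complements are orthogonal, adjoints are inverses, and multiplicities are bounded through
  Hilbert-Schmidt norms. A subspace is carried by a matrix A with A^*A = 1, which turns dimension
  arguments into statements about traces.\<close>

definition adj :: "complex mat \<Rightarrow> complex mat" where
  "adj A = mat (dim_col A) (dim_row A) (\<lambda>(i, j). cnj (A $$ (j, i)))"

lemma dim_adj [simp]: "dim_row (adj A) = dim_col A" "dim_col (adj A) = dim_row A"
  by (simp_all add: adj_def)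

lemma adj_carrier [simp]: "adj A \<in> carrier_mat m n \<longleftrightarrow> A \<in> carrier_mat n m"
  unfolding carrier_mat_def by auto

lemma index_adj [simp]: "i < dim_col A \<Longrightarrow> j < dim_row A \<Longrightarrow> adj A $$ (i, j) = cnj (A $$ (j, i))"
  by (simp add: adj_def)

lemma adj_adj [simp]: "adj (adj A) = A"
  by (rule eq_matI) auto

lemma adj_one [simp]: "adj (1\<^sub>m n) = 1\<^sub>m n"
  by (rule eq_matI) auto

lemma adj_zero [simp]: "adj (0\<^sub>m n m) = 0\<^sub>m m n"
  by (rule eq_matI) auto

lemma adj_mult:
  assumes "A \<in> carrier_mat n m" "B \<in> carrier_mat m k"
  shows "adj (A * B) = adj B * adj A"
  using assms by (intro eq_matI) (auto simp: scalar_prod_def mult.commute intro!: sum.cong)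

lemma adj_minus:
  assumes "A \<in> carrier_mat n m" "B \<in> carrier_mat n m"
  shows "adj (A - B) = adj A - adj B"
  using assms by (intro eq_matI) auto

lemma trace_mult_comm:
  fixes A B :: "'b :: comm_semiring_0 mat"
  assumes "A \<in> carrier_mat n m" "B \<in> carrier_mat m n"
  shows "mat_trace (A * B) = mat_trace (B * A)"
proof -
  have "mat_trace (A * B) = (\<Sum>i<n. \<Sum>j<m. A $$ (i, j) * B $$ (j, i))"
    using assms by (auto simp: mat_trace_def scalar_prod_def lessThan_atLeast0 intro!: sum.cong)
  also have "\<dots> = (\<Sum>j<m. \<Sum>i<n. B $$ (j, i) * A $$ (i, j))"
    by (subst sum.swap) (simp add: mult.commute)
  also have "\<dots> = mat_trace (B * A)"
    using assms by (auto simp: mat_trace_def scalar_prod_def lessThan_atLeast0 intro!: sum.cong)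
  finally show ?thesis .
qed

lemma trace_minus:
  fixes A B :: "'b :: ab_group_add mat"
  assumes "A \<in> carrier_mat n n" "B \<in> carrier_mat n n"
  shows "mat_trace (A - B) = mat_trace A - mat_trace B"
  using assms by (auto simp: mat_trace_def sum_subtractf)

lemma trace_one [simp]: "mat_trace (1\<^sub>m n :: 'b :: semiring_1 mat) = of_nat n"
  by (simp add: mat_trace_def)

text \<open>This is the squared Hilbert-Schmidt norm of \<open>A\<close>; its positivity and
  definiteness drive all later dimension and multiplicity bounds.\<close>

lemma trace_adj_mult_self:
  assumes "A \<in> carrier_mat n m"
  shows "mat_trace (adj A * A) = of_real (\<Sum>j<m. \<Sum>i<n. (cmod (A $$ (i, j)))\<^sup>2)"
proof -
  have *: "cnj z * z = of_real ((cmod z)\<^sup>2)" for z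
    by (metis complex_norm_square mult.commute)
  show ?thesis
    using assms by (simp add: mat_trace_def scalar_prod_def lessThan_atLeast0 * del: of_real_power)
qed

lemma trace_adj_mult_self_ge_0: "0 \<le> Re (mat_trace (adj A * A))"
  by (simp add: trace_adj_mult_self[of A "dim_row A" "dim_col A"] sum_nonneg del: of_real_sum)

lemma trace_adj_mult_self_eq_0:
  assumes "A \<in> carrier_mat n m" "mat_trace (adj A * A) = 0"
  shows "A = 0\<^sub>m n m"
proof -
  have "(\<Sum>j<m. \<Sum>i<n. (cmod (A $$ (i, j)))\<^sup>2) = 0"
    using assms(2) unfolding trace_adj_mult_self[OF assms(1)] of_real_eq_0_iff .
  then have "\<forall>j<m. \<forall>i<n. A $$ (i, j) = 0"
    by (simp add: sum_nonneg_eq_0_iff sum_nonneg)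
  with assms(1) show ?thesis by (intro eq_matI) auto
qed

lemma mult_mat_cancel:
  fixes M :: "'b :: semiring_1 mat"
  assumes "X * Y = 1\<^sub>m n" "X \<in> carrier_mat n m" "Y \<in> carrier_mat m n" "M \<in> carrier_mat n k"
  shows "X * (Y * M) = M"
  using assms by (metis assoc_mult_mat left_mult_one_mat)

text \<open>\<open>D\<close> is the orthogonal projection onto the complement of the range of
  \<open>A\<close>. Being a projection, it has its trace as its squared norm, so m - k is the square
  of a norm.\<close>

lemma isometry_complement:
  assumes A: "A \<in> carrier_mat m k" and iso: "adj A * A = 1\<^sub>m k"
  defines "D \<equiv> 1\<^sub>m m - A * adj A"
  shows "adj D * D = D" "mat_trace D = of_nat m - of_nat k"
proof -
  have c: "adj A \<in> carrier_mat k m" "A * adj A \<in> carrier_mat m m" using A by auto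
  have adjD: "adj D = D" unfolding D_def using A c
    by (simp add: adj_minus[of _ m m] adj_mult[of _ m k])
  let ?P = "A * adj A"
  have "?P * ?P = A * (adj A * (A * adj A))"
    using A by (intro assoc_mult_mat[of _ m k _ m]) auto
  also have "\<dots> = ?P" using A iso mult_mat_cancel[OF iso, of m "adj A" m] by simp
  finally have PP: "?P * ?P = ?P" .
  have "D * D = 1\<^sub>m m * D - ?P * D"
    unfolding D_def using c by (intro minus_mult_distrib_mat[of _ m m]) auto
  also have "?P * D = ?P * 1\<^sub>m m - ?P * ?P"
    unfolding D_def using c by (intro mult_minus_distrib_mat[of _ m m]) auto
  finally have "D * D = D"
    using c A unfolding PP D_def by (auto intro!: eq_matI)
  with adjD show "adj D * D = D" by simp
  show "mat_trace D = of_nat m - of_nat k"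
    unfolding D_def using c A by (simp add: trace_minus[of _ m] trace_mult_comm[of A m k] iso)
qed

text \<open>The number m - k is the squared norm of the complementary projection, hence nonnegative,
  and the projection vanishes when m - k is zero.\<close>

lemma isometry_dim:
  assumes A: "A \<in> carrier_mat m k" and iso: "adj A * A = 1\<^sub>m k"
  shows "k \<le> m" and "k = m \<Longrightarrow> A * adj A = 1\<^sub>m m"
proof -
  let ?D = "1\<^sub>m m - A * adj A"
  note D = isometry_complement[OF A iso]
  show "k \<le> m"
    using trace_adj_mult_self_ge_0[of ?D] unfolding D by simp
  assume "k = m"
  then have "mat_trace (adj ?D * ?D) = 0" unfolding D by simp
  then have D0: "?D = 0\<^sub>m m m" using A by (intro trace_adj_mult_self_eq_0) auto
  show "A * adj A = 1\<^sub>m m"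
  proof (rule eq_matI)
    fix i j assume "i < dim_row (1\<^sub>m m)" "j < dim_col (1\<^sub>m m)"
    with A arg_cong[OF D0, of "\<lambda>M. M $$ (i, j)"]
    show "(A * adj A) $$ (i, j) = 1\<^sub>m m $$ (i, j)" by simp
  qed (use A in auto)
qed

text \<open>The columns of \<open>A\<close> form an orthonormal family in \<open>W\<close> of
  greatest size, which exists because \<open>isometry_dim\<close> bounds the size by m. A vector of
  \<open>W\<close> not recovered by \<open>A * adj A\<close> would allow one more Gram-Schmidt
  step.\<close>

lemma orthonormal_basis:
  fixes W :: "complex vec set"
  assumes W: "W \<subseteq> carrier_vec m" "0\<^sub>v m \<in> W"
    and add: "\<And>v w. v \<in> W \<Longrightarrow> w \<in> W \<Longrightarrow> v + w \<in> W"
    and smult: "\<And>c v. v \<in> W \<Longrightarrow> c \<cdot>\<^sub>v v \<in> W"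
  obtains k A where "A \<in> carrier_mat m k" "adj A * A = 1\<^sub>m k"
    "\<And>x. x \<in> carrier_vec k \<Longrightarrow> A *\<^sub>v x \<in> W"
    "\<And>w. w \<in> W \<Longrightarrow> A *\<^sub>v (adj A *\<^sub>v w) = w"
proof -
  define P where "P k \<longleftrightarrow> (\<exists>A \<in> carrier_mat m k. adj A * A = 1\<^sub>m k \<and>
      (\<forall>x \<in> carrier_vec k. A *\<^sub>v x \<in> W))" for k
  have "P 0"
    unfolding P_def
  proof (intro bexI conjI ballI)
    show "adj (0\<^sub>m m 0) * 0\<^sub>m m 0 = 1\<^sub>m 0" by (rule eq_matI) auto
    fix x :: "complex vec" assume "x \<in> carrier_vec 0"
    then have "0\<^sub>m m 0 *\<^sub>v x = 0\<^sub>v m" by (intro eq_vecI) (auto simp: scalar_prod_def)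
    with W show "0\<^sub>m m 0 *\<^sub>v x \<in> W" by simp
  qed auto
  moreover have bound: "k \<le> m" if "P k" for k
    using that isometry_dim(1) unfolding P_def by blast
  ultimately obtain k where k: "P k" and k_max: "\<And>l. P l \<Longrightarrow> l \<le> k"
    using ex_has_greatest_nat[of P 0 id "Suc m"] by (auto simp: less_Suc_eq_le)
  obtain A where A: "A \<in> carrier_mat m k" "adj A * A = 1\<^sub>m k"
    and AW: "\<And>x. x \<in> carrier_vec k \<Longrightarrow> A *\<^sub>v x \<in> W"
    using k unfolding P_def by blast
  have "A *\<^sub>v (adj A *\<^sub>v w) = w" if w: "w \<in> W" for w
  proof (rule ccontr)
    assume neq: "A *\<^sub>v (adj A *\<^sub>v w) \<noteq> w"
    have wc: "w \<in> carrier_vec m" using w W by auto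
    \<comment> \<open>The Gram-Schmidt residual of \<open>w\<close>: it lies in \<open>W\<close>, is
      nonzero by assumption, and is orthogonal to all columns of \<open>A\<close>.\<close>
    define u where "u = w + (-1) \<cdot>\<^sub>v (A *\<^sub>v (adj A *\<^sub>v w))"
    have uW: "u \<in> W" unfolding u_def
      using A wc by (intro add w smult AW) auto
    have uc: "u \<in> carrier_vec m" using uW W by auto
    have "u \<noteq> 0\<^sub>v m"
    proof
      assume u0: "u = 0\<^sub>v m"
      have "A *\<^sub>v (adj A *\<^sub>v w) = w"
      proof (rule eq_vecI)
        fix i assume "i < dim_vec w"
        with u0 A wc show "(A *\<^sub>v (adj A *\<^sub>v w)) $ i = w $ i"
          unfolding u_def by (auto simp: vec_eq_iff)
      qed (use A wc in auto)
      with neq show False by simp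
    qed
    then obtain i where i: "i < m" "u $ i \<noteq> 0" using uc by (auto simp: vec_eq_iff)
    have Au: "adj A *\<^sub>v u = 0\<^sub>v k"
    proof -
      have "adj A *\<^sub>v u = adj A *\<^sub>v w + (-1) \<cdot>\<^sub>v (adj A *\<^sub>v (A *\<^sub>v (adj A *\<^sub>v w)))"
        unfolding u_def using A wc
        by (subst mult_add_distrib_mat_vec[of _ k m]) (auto simp: mult_mat_vec[of _ k m])
      also have "adj A *\<^sub>v (A *\<^sub>v (adj A *\<^sub>v w)) = adj A *\<^sub>v w"
        using A wc by (subst assoc_mult_mat_vec[of _ k m _ k, symmetric]) auto
      finally show ?thesis using A wc by (auto intro!: eq_vecI)
    qed
    define s where "s = (\<Sum>i<m. (cmod (u $ i))\<^sup>2)"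
    have s: "s > 0" unfolding s_def using i by (intro sum_pos2[of _ i]) auto
    define c where "c = complex_of_real (1 / sqrt s)"
    \<comment> \<open>The normalised residual becomes the last column, with index k;
      \<open>c\<close> is the reciprocal of the norm of \<open>u\<close>.\<close>
    define B where "B = mat m (Suc k) (\<lambda>(i, j). if j < k then A $$ (i, j) else c * u $ i)"
    have "P (Suc k)"
      unfolding P_def
    proof (intro bexI conjI ballI)
      show "B \<in> carrier_mat m (Suc k)" by (simp add: B_def)
      have o: "(\<Sum>i<m. cnj (A $$ (i, j)) * u $ i) = 0" if "j < k" for j
        using arg_cong[OF Au, of "\<lambda>v. v $ j"] that A uc
        by (simp add: scalar_prod_def lessThan_atLeast0)
      have o': "(\<Sum>i<m. cnj (u $ i) * A $$ (i, j)) = 0" if "j < k" for j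
        using arg_cong[OF o[OF that], of cnj] by (simp add: mult.commute)
      have e: "(\<Sum>l<m. cnj (A $$ (l, i)) * A $$ (l, j)) = (if i = j then 1 else 0)"
        if "i < k" "j < k" for i j
        using arg_cong[OF A(2), of "\<lambda>M. M $$ (i, j)"] that A(1)
        by (simp add: scalar_prod_def lessThan_atLeast0)
      have n: "(\<Sum>i<m. cnj (c * u $ i) * (c * u $ i)) = 1"
      proof -
        have "(\<Sum>i<m. cnj (c * u $ i) * (c * u $ i)) = (\<Sum>i<m. of_real (1 / s * (cmod (u $ i))\<^sup>2))"
        proof (intro sum.cong refl)
          fix i
          have "cnj (c * u $ i) * (c * u $ i) = of_real ((cmod (c * u $ i))\<^sup>2)"
            by (subst complex_norm_square) (simp add: mult.commute)
          also have "(cmod (c * u $ i))\<^sup>2 = 1 / s * (cmod (u $ i))\<^sup>2"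
            using s by (simp add: c_def norm_mult norm_divide power_mult_distrib power_divide)
          finally show "cnj (c * u $ i) * (c * u $ i) = of_real (1 / s * (cmod (u $ i))\<^sup>2)" .
        qed
        also have "\<dots> = of_real (1 / s * s)"
          by (simp add: s_def sum_distrib_left sum_divide_distrib)
        finally show ?thesis using s by simp
      qed
      have o1: "(\<Sum>i<m. cnj (A $$ (i, j)) * (c * u $ i)) = 0" if "j < k" for j
      proof -
        have "(\<Sum>i<m. cnj (A $$ (i, j)) * (c * u $ i)) = c * (\<Sum>i<m. cnj (A $$ (i, j)) * u $ i)"
          by (simp add: sum_distrib_left mult.left_commute)
        then show ?thesis using o[OF that] by simp
      qed
      have o2: "(\<Sum>i<m. cnj (c * u $ i) * A $$ (i, j)) = 0" if "j < k" for j
      proof -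
        have "(\<Sum>i<m. cnj (c * u $ i) * A $$ (i, j)) = cnj c * (\<Sum>i<m. cnj (u $ i) * A $$ (i, j))"
          by (simp add: sum_distrib_left mult.assoc)
        then show ?thesis using o'[OF that] by simp
      qed
      show "adj B * B = 1\<^sub>m (Suc k)"
      proof (rule eq_matI)
        fix i j assume "i < dim_row (1\<^sub>m (Suc k))" "j < dim_col (1\<^sub>m (Suc k))"
        then have ij: "i < Suc k" "j < Suc k" by auto
        have "(adj B * B) $$ (i, j) = (\<Sum>l<m. cnj (B $$ (l, i)) * B $$ (l, j))"
          using ij by (simp add: B_def scalar_prod_def lessThan_atLeast0)
        also have "\<dots> = (if i = j then 1 else 0)"
          using ij e[of i j] o1[of i] o2[of j] n
          by (cases "i < k"; cases "j < k") (auto simp: B_def)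
        finally show "(adj B * B) $$ (i, j) = 1\<^sub>m (Suc k) $$ (i, j)" using ij by simp
      qed (auto simp: B_def)
      fix x :: "complex vec" assume x: "x \<in> carrier_vec (Suc k)"
      have "B *\<^sub>v x = A *\<^sub>v vec k (\<lambda>j. x $ j) + (x $ k * c) \<cdot>\<^sub>v u"
        using A uc x
        by (intro eq_vecI) (auto simp: B_def scalar_prod_def mult.commute intro!: sum.cong)
      also have "\<dots> \<in> W" by (intro add AW smult uW) auto
      finally show "B *\<^sub>v x \<in> W" .
    qed
    from k_max[OF this] show False by simp
  qed
  with A AW that show thesis by blast
qed

section \<open>Unitary representations\<close>

text \<open>For a representation, adjoint equal to value at the inverse is the same as unitarity of
  every matrix. In this form the adjoint of a relation at the inverse of g is directly a relation at
  g.\<close>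

definition unitary_rep :: "('g, 'm) monoid_scheme \<Rightarrow> nat \<Rightarrow> ('g \<Rightarrow> complex mat) \<Rightarrow> bool" where
  "unitary_rep G n \<rho> \<longleftrightarrow> is_rep G n \<rho> \<and> (\<forall>g\<in>carrier G. adj (\<rho> g) = \<rho> (inv\<^bsub>G\<^esub> g))"

lemma unitary_repD:
  assumes "unitary_rep G n \<rho>"
  shows "g \<in> carrier G \<Longrightarrow> \<rho> g \<in> carrier_mat n n"
    and "\<rho> \<one>\<^bsub>G\<^esub> = 1\<^sub>m n"
    and "g \<in> carrier G \<Longrightarrow> h \<in> carrier G \<Longrightarrow> \<rho> (g \<otimes>\<^bsub>G\<^esub> h) = \<rho> g * \<rho> h"
    and "g \<in> carrier G \<Longrightarrow> adj (\<rho> g) = \<rho> (inv\<^bsub>G\<^esub> g)"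
  using assms by (auto simp: unitary_rep_def is_rep_def)

text \<open>The hypothesis on \<open>\<rho> g * A\<close> says that the range of \<open>A\<close> is
  invariant: the projection \<open>A * adj A\<close> fixes the columns of
  \<open>\<rho> g * A\<close>. This is what allows \<open>A * adj A\<close> to be inserted between
  two factors and makes the compression multiplicative.\<close>

lemma unitary_rep_compress:
  fixes G (structure)
  assumes G: "group G" and \<rho>: "unitary_rep G n \<rho>"
    and A: "A \<in> carrier_mat n k" "adj A * A = 1\<^sub>m k"
    and inv: "\<And>g. g \<in> carrier G \<Longrightarrow> \<rho> g * A = A * (adj A * (\<rho> g * A))"
  shows "unitary_rep G k (\<lambda>g. adj A * (\<rho> g * A))"
  unfolding unitary_rep_def is_rep_def
proof (intro conjI ballI)
  interpret group G by fact
  note \<rho>D = unitary_repD[OF \<rho>]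
  have aA: "adj A \<in> carrier_mat k n" using A by simp
  fix g assume g: "g \<in> carrier G"
  note \<rho>g = \<rho>D(1)[OF g]
  show "adj A * (\<rho> g * A) \<in> carrier_mat k k" using A \<rho>g by auto
  have "adj (adj A * (\<rho> g * A)) = adj (\<rho> g * A) * A"
    using A \<rho>g by (subst adj_mult[of _ k n _ k]) auto
  also have "\<dots> = adj A * (adj (\<rho> g) * A)"
    using A \<rho>g by (simp add: adj_mult[of _ n n _ k] assoc_mult_mat[of _ k n _ n])
  finally show "adj (adj A * (\<rho> g * A)) = adj A * (\<rho> (inv g) * A)"
    by (simp add: \<rho>D(4)[OF g])
  fix h assume h: "h \<in> carrier G"
  note \<rho>h = \<rho>D(1)[OF h]
  have "adj A * (\<rho> (g \<otimes> h) * A) = adj A * (\<rho> g * (\<rho> h * A))"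
    using A \<rho>g \<rho>h by (simp add: \<rho>D(3)[OF g h] assoc_mult_mat[of _ n n _ n _ k])
  also have "\<rho> h * A = A * (adj A * (\<rho> h * A))" by (rule inv[OF h])
  also have "\<rho> g * \<dots> = (\<rho> g * A) * (adj A * (\<rho> h * A))"
    using A \<rho>g \<rho>h by (intro assoc_mult_mat[of _ n n _ k _ k, symmetric]) auto
  also have "adj A * \<dots> = (adj A * (\<rho> g * A)) * (adj A * (\<rho> h * A))"
    using A \<rho>g \<rho>h by (intro assoc_mult_mat[of _ k n _ k _ k, symmetric]) auto
  finally show "adj A * (\<rho> (g \<otimes> h) * A) = adj A * (\<rho> g * A) * (adj A * (\<rho> h * A))" .
next
  show "adj A * (\<rho> \<one>\<^bsub>G\<^esub> * A) = 1\<^sub>m k"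
    using A by (simp add: unitary_repD(2)[OF \<rho>])
qed

lemma eq_mat_by_vec:
  fixes A B :: "'b :: semiring_1 mat"
  assumes "A \<in> carrier_mat n k" "B \<in> carrier_mat n k"
    and "\<And>v. v \<in> carrier_vec k \<Longrightarrow> A *\<^sub>v v = B *\<^sub>v v"
  shows "A = B"
proof (rule eq_matI)
  fix i j assume "i < dim_row B" "j < dim_col B"
  with assms(1,2) arg_cong[OF assms(3)[of "unit_vec k j"], of "\<lambda>v. v $ i"]
  show "A $$ (i, j) = B $$ (i, j)" by simp
qed (use assms in auto)

lemma mult_zero_vec [simp]: "A \<in> carrier_mat n k \<Longrightarrow> A *\<^sub>v 0\<^sub>v k = 0\<^sub>v n"
  by (intro eq_vecI) auto

text \<open>Complete reducibility with both halves given by isometries: \<open>A\<close> spans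
  \<open>W\<close> and \<open>B\<close> spans its orthogonal complement, which unitarity makes
  invariant.\<close>

lemma unitary_rep_split:
  fixes G (structure)
  assumes G: "group G" and \<psi>: "unitary_rep G m \<psi>"
    and W: "invariant_subspace G m \<psi> W" "W \<noteq> {0\<^sub>v m}" "W \<noteq> carrier_vec m"
  obtains k l A B where "k < m" "l < m" "A \<in> carrier_mat m k" "B \<in> carrier_mat m l"
    "adj A * A = 1\<^sub>m k" "adj B * B = 1\<^sub>m l" "A * adj A + B * adj B = 1\<^sub>m m"
    "\<And>g. g \<in> carrier G \<Longrightarrow> \<psi> g * A = A * (adj A * (\<psi> g * A))"
    "\<And>g. g \<in> carrier G \<Longrightarrow> \<psi> g * B = B * (adj B * (\<psi> g * B))"
proof -
  interpret group G by fact
  note \<psi>D = unitary_repD[OF \<psi>]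
  have W_sub: "W \<subseteq> carrier_vec m" and W0: "0\<^sub>v m \<in> W"
    and W_inv: "\<And>g w. g \<in> carrier G \<Longrightarrow> w \<in> W \<Longrightarrow> \<psi> g *\<^sub>v w \<in> W"
    using W(1) unfolding invariant_subspace_def by auto
  obtain k A where A: "A \<in> carrier_mat m k" "adj A * A = 1\<^sub>m k"
    and AW: "\<And>x. x \<in> carrier_vec k \<Longrightarrow> A *\<^sub>v x \<in> W"
    and WA: "\<And>w. w \<in> W \<Longrightarrow> A *\<^sub>v (adj A *\<^sub>v w) = w"
    by (rule orthonormal_basis[of W m])
      (use W(1) in \<open>auto simp: invariant_subspace_def\<close>)
  \<comment> \<open>The kernel of \<open>adj A\<close> is the orthogonal complement of
    \<open>W\<close>.\<close>
  define U where "U = {v \<in> carrier_vec m. adj A *\<^sub>v v = 0\<^sub>v k}"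
  have aA: "adj A \<in> carrier_mat k m" using A by simp
  obtain l B where B: "B \<in> carrier_mat m l" "adj B * B = 1\<^sub>m l"
    and BU: "\<And>x. x \<in> carrier_vec l \<Longrightarrow> B *\<^sub>v x \<in> U"
    and UB: "\<And>w. w \<in> U \<Longrightarrow> B *\<^sub>v (adj B *\<^sub>v w) = w"
    by (rule orthonormal_basis[of U m])
      (use aA in \<open>auto simp: U_def mult_add_distrib_mat_vec[of _ k m] mult_mat_vec[of _ k m]\<close>)
  have aB: "adj B \<in> carrier_mat l m" using B by simp
  have AB: "adj A * B = 0\<^sub>m k l"
  proof (rule eq_mat_by_vec[of _ k l])
    fix v :: "complex vec" assume v: "v \<in> carrier_vec l"
    then have "(adj A * B) *\<^sub>v v = 0\<^sub>v k"
      using BU[OF v] assoc_mult_mat_vec[OF aA B(1) v] by (simp add: U_def)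
    then show "(adj A * B) *\<^sub>v v = 0\<^sub>m k l *\<^sub>v v" using v by (auto intro!: eq_vecI)
  qed (use aA B in auto)
  have BA: "adj B * A = 0\<^sub>m l k"
    using arg_cong[OF AB, of adj] aA B by (simp add: adj_mult[of _ k m _ l])
  have sum1: "A * adj A + B * adj B = 1\<^sub>m m"
  proof (rule eq_mat_by_vec[of _ m m])
    fix v :: "complex vec" assume v: "v \<in> carrier_vec m"
    \<comment> \<open>The component of \<open>v\<close> outside \<open>W\<close>. It lies in
      \<open>U\<close>, so \<open>B\<close> recovers it, and it has the same image under
      \<open>adj B\<close> as \<open>v\<close> because \<open>adj B * A\<close> vanishes.\<close>
    define u where "u = v - A *\<^sub>v (adj A *\<^sub>v v)"
    have c: "adj A *\<^sub>v v \<in> carrier_vec k" "A *\<^sub>v (adj A *\<^sub>v v) \<in> carrier_vec m"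
      using A(1) v by auto
    have "adj A *\<^sub>v u = adj A *\<^sub>v v - adj A *\<^sub>v (A *\<^sub>v (adj A *\<^sub>v v))"
      unfolding u_def using aA v c by (intro mult_minus_distrib_mat_vec) auto
    also have "adj A *\<^sub>v (A *\<^sub>v (adj A *\<^sub>v v)) = adj A *\<^sub>v v"
      using A c by (subst assoc_mult_mat_vec[OF aA, symmetric]) auto
    finally have "adj A *\<^sub>v u = 0\<^sub>v k" using c by simp
    then have "u \<in> U" using v c by (simp add: U_def u_def)
    from UB[OF this] have "u = B *\<^sub>v (adj B *\<^sub>v u)" ..
    also have "adj B *\<^sub>v u = adj B *\<^sub>v v - adj B *\<^sub>v (A *\<^sub>v (adj A *\<^sub>v v))"
      unfolding u_def using aB v c by (intro mult_minus_distrib_mat_vec) auto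
    also have "adj B *\<^sub>v (A *\<^sub>v (adj A *\<^sub>v v)) = 0\<^sub>v l"
      using A c BA by (subst assoc_mult_mat_vec[OF aB, symmetric]) (auto intro!: eq_vecI)
    finally have u: "u = B *\<^sub>v (adj B *\<^sub>v v)" using aB v by auto
    have "(A * adj A + B * adj B) *\<^sub>v v = A *\<^sub>v (adj A *\<^sub>v v) + B *\<^sub>v (adj B *\<^sub>v v)"
      using A(1) B(1) v aA aB
      by (subst add_mult_distrib_mat_vec[of _ m m]) (auto simp: assoc_mult_mat_vec[of _ m _ _ m])
    also have "\<dots> = v"
    proof -
      have "x + (v - x) = v" if "x \<in> carrier_vec m" for x using that v by auto
      from this[OF c(2)] show ?thesis unfolding u[symmetric] u_def .
    qed
    finally show "(A * adj A + B * adj B) *\<^sub>v v = 1\<^sub>m m *\<^sub>v v" using v by simp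
  qed (use A B in auto)
  have Ainv: "\<psi> g * A = A * (adj A * (\<psi> g * A))" if g: "g \<in> carrier G" for g
  proof (rule eq_mat_by_vec[of _ m k])
    fix v :: "complex vec" assume v: "v \<in> carrier_vec k"
    note \<psi>g = \<psi>D(1)[OF g]
    have "(A * (adj A * (\<psi> g * A))) *\<^sub>v v = A *\<^sub>v (adj A *\<^sub>v (\<psi> g *\<^sub>v (A *\<^sub>v v)))"
      using A(1) aA \<psi>g v
      by (simp add: assoc_mult_mat_vec[of _ m k _ k] assoc_mult_mat_vec[of _ k m _ k]
          assoc_mult_mat_vec[of _ m m _ k])
    also have "\<dots> = (\<psi> g * A) *\<^sub>v v"
      using WA[OF W_inv[OF g AW[OF v]]] A(1) \<psi>g v by (simp add: assoc_mult_mat_vec[of _ m m _ k])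
    finally show "(\<psi> g * A) *\<^sub>v v = (A * (adj A * (\<psi> g * A))) *\<^sub>v v" ..
  qed (use A \<psi>D(1)[OF g] in auto)
  have Binv: "\<psi> g * B = B * (adj B * (\<psi> g * B))" if g: "g \<in> carrier G" for g
  proof -
    note \<psi>g = \<psi>D(1)[OF g]
    have gB: "\<psi> g * B \<in> carrier_mat m l" using \<psi>g B(1) by auto
    \<comment> \<open>Taking adjoints in the invariance of \<open>W\<close> under the inverse of g
      moves \<open>\<psi> g\<close> to the left of \<open>adj A\<close>; then
      \<open>adj A * B = 0\<close> shows that \<open>\<psi> g * B\<close> has no component in
      \<open>W\<close>.\<close>
    have "adj (\<psi> (inv g) * A) = adj A * \<psi> g"
      using A(1) \<psi>D(1)[of "inv g"] \<psi>D(4)[of "inv g"] g by (simp add: adj_mult[of _ m m _ k])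
    moreover have "adj (A * (adj A * (\<psi> (inv g) * A))) = adj (adj A * (\<psi> (inv g) * A)) * adj A"
      using A(1) \<psi>D(1)[of "inv g"] g by (intro adj_mult[of _ m k _ k]) auto
    ultimately have "adj A * \<psi> g = adj (adj A * (\<psi> (inv g) * A)) * adj A"
      using Ainv[of "inv g"] g by simp
    then have "adj A * (\<psi> g * B) = adj (adj A * (\<psi> (inv g) * A)) * adj A * B"
      using assoc_mult_mat[OF aA \<psi>g B(1)] by simp
    also have "\<dots> = adj (adj A * (\<psi> (inv g) * A)) * (adj A * B)"
      using aA B(1) A(1) \<psi>D(1)[of "inv g"] g by (intro assoc_mult_mat[of _ k k _ m _ l]) auto
    also have "\<dots> = 0\<^sub>m k l"
      unfolding AB using aA A(1) by (intro right_mult_zero_mat) auto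
    finally have z: "adj A * (\<psi> g * B) = 0\<^sub>m k l" .
    have "\<psi> g * B = (A * adj A + B * adj B) * (\<psi> g * B)"
      unfolding sum1 left_mult_one_mat[OF gB] ..
    also have "\<dots> = A * adj A * (\<psi> g * B) + B * adj B * (\<psi> g * B)"
      using A(1) B(1) aA aB gB by (intro add_mult_distrib_mat[of _ m m]) auto
    also have "\<dots> = A * (adj A * (\<psi> g * B)) + B * (adj B * (\<psi> g * B))"
      using A(1) B(1) aA aB gB by (simp add: assoc_mult_mat[of _ m k _ m] assoc_mult_mat[of _ m l _ m])
    also have "\<dots> = B * (adj B * (\<psi> g * B))"
      using A(1) B(1) aB gB by (simp add: z)
    finally show ?thesis .
  qed
  \<comment> \<open>A square isometry is onto, so k = m would make \<open>W\<close> the whole space;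
    in the same way l = m would make the complement everything and \<open>W\<close> zero.\<close>
  have km: "k \<noteq> m"
  proof
    assume "k = m"
    with isometry_dim(2)[OF A] have "A * adj A = 1\<^sub>m m" by simp
    then have "v \<in> W" if "v \<in> carrier_vec m" for v
      using AW[of "adj A *\<^sub>v v"] that aA assoc_mult_mat_vec[OF A(1) aA that] by simp
    with W(3) W_sub show False by auto
  qed
  have lm: "l \<noteq> m"
  proof
    assume "l = m"
    with isometry_dim(2)[OF B] have BB: "B * adj B = 1\<^sub>m m" by simp
    have "w = 0\<^sub>v m" if w: "w \<in> W" for w
    proof -
      have wc: "w \<in> carrier_vec m" using w W_sub by auto
      have "B *\<^sub>v (adj B *\<^sub>v w) = w"
        using BB assoc_mult_mat_vec[OF B(1) aB wc] wc by simp
      with BU[of "adj B *\<^sub>v w"] aB wc have "w \<in> U" by simp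
      with WA[OF w] A(1) show ?thesis by (simp add: U_def)
    qed
    with W(2) W0 show False by blast
  qed
  from that[OF _ _ A(1) B(1) A(2) B(2) sum1 Ainv Binv] km lm
    isometry_dim(1)[OF A] isometry_dim(1)[OF B] show thesis by simp
qed

text \<open>A constituent of least degree on which \<open>C\<close> does not vanish is irreducible: otherwise \<open>C\<close>
  vanishes on both halves of an orthogonal splitting of it.\<close>

lemma irreducible_constituent:
  assumes G: "group G" and \<rho>: "unitary_rep G n \<rho>"
    and C: "C \<in> carrier_mat n n" "C \<noteq> 0\<^sub>m n n"
  obtains d V \<psi> where "V \<in> carrier_mat n d" "adj V * V = 1\<^sub>m d"
    "unitary_rep G d \<psi>" "is_irrep G d \<psi>"
    "\<And>g. g \<in> carrier G \<Longrightarrow> \<rho> g * V = V * \<psi> g" "C * V \<noteq> 0\<^sub>m n d"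
proof -
  define P where "P d V \<psi> \<longleftrightarrow> V \<in> carrier_mat n d \<and> adj V * V = 1\<^sub>m d \<and> unitary_rep G d \<psi> \<and>
    (\<forall>g\<in>carrier G. \<rho> g * V = V * \<psi> g) \<and> C * V \<noteq> 0\<^sub>m n d" for d V \<psi>
  note \<rho>D = unitary_repD[OF \<rho>]
  have "P n (1\<^sub>m n) \<rho>"
    unfolding P_def using \<rho> C by (auto simp: left_mult_one_mat[OF \<rho>D(1)] right_mult_one_mat[OF \<rho>D(1)])
  then have "\<exists>d. \<exists>V \<psi>. P d V \<psi>" by blast
  then obtain d where "\<exists>V \<psi>. P d V \<psi>" and least: "\<And>k V \<psi>. k < d \<Longrightarrow> \<not> P k V \<psi>"
    using exists_least_iff[of "\<lambda>d. \<exists>V \<psi>. P d V \<psi>"] by blast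
  then obtain V \<psi> where "P d V \<psi>" by blast
  then have V: "V \<in> carrier_mat n d" "adj V * V = 1\<^sub>m d" and \<psi>: "unitary_rep G d \<psi>"
    and int: "\<And>g. g \<in> carrier G \<Longrightarrow> \<rho> g * V = V * \<psi> g" and CV: "C * V \<noteq> 0\<^sub>m n d"
    by (auto simp: P_def)
  note \<psi>D = unitary_repD[OF \<psi>]
  \<comment> \<open>Composing isometries, \<open>V * A\<close> would carry a constituent of smaller
    degree, so by the choice of d the matrix \<open>C\<close> has to vanish on it.\<close>
  have sub: "C * V * A = 0\<^sub>m n k"
    if "k < d" and A: "A \<in> carrier_mat d k" "adj A * A = 1\<^sub>m k"
      and inv: "\<And>g. g \<in> carrier G \<Longrightarrow> \<psi> g * A = A * (adj A * (\<psi> g * A))" for k A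
  proof -
    have "V * A \<in> carrier_mat n k" using V A by auto
    moreover have "adj (V * A) * (V * A) = 1\<^sub>m k"
    proof -
      have "adj (V * A) * (V * A) = adj A * adj V * (V * A)"
        using V A by (simp add: adj_mult[of _ n d _ k])
      also have "\<dots> = adj A * (adj V * (V * A))"
        using V A by (intro assoc_mult_mat[of _ k d _ n _ k]) auto
      also have "adj V * (V * A) = A"
        using V A by (intro mult_mat_cancel[of _ _ d n]) auto
      finally show ?thesis using A by simp
    qed
    moreover have "unitary_rep G k (\<lambda>g. adj A * (\<psi> g * A))"
      by (rule unitary_rep_compress[OF G \<psi> A inv])
    moreover have "\<rho> g * (V * A) = V * A * (adj A * (\<psi> g * A))" if g: "g \<in> carrier G" for g
    proof -
      have "\<rho> g * (V * A) = \<rho> g * V * A"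
        by (rule assoc_mult_mat[OF \<rho>D(1)[OF g] V(1) A(1), symmetric])
      also have "\<dots> = V * (\<psi> g * A)"
        unfolding int[OF g] by (rule assoc_mult_mat[OF V(1) \<psi>D(1)[OF g] A(1)])
      also have "\<dots> = V * (A * (adj A * (\<psi> g * A)))" using inv[OF g] by simp
      also have "\<dots> = V * A * (adj A * (\<psi> g * A))"
        using V A \<psi>D(1)[OF g] by (intro assoc_mult_mat[of _ n d _ k _ k, symmetric]) auto
      finally show ?thesis .
    qed
    ultimately have "C * (V * A) = 0\<^sub>m n k"
      using least[OF that(1), of "V * A" "\<lambda>g. adj A * (\<psi> g * A)"] by (auto simp: P_def)
    then show ?thesis using C V A by (simp add: assoc_mult_mat[of _ n n _ d _ k])
  qed
  have "is_irrep G d \<psi>"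
    unfolding is_irrep_def
  proof (intro conjI notI)
    show "is_rep G d \<psi>" using \<psi> by (simp add: unitary_rep_def)
    have "C * V = 0\<^sub>m n d" if "d = 0"
      by (rule eq_matI) (use that C V in simp_all)
    with CV show "0 < d" by blast
    assume "\<exists>W. invariant_subspace G d \<psi> W \<and> W \<noteq> {0\<^sub>v d} \<and> W \<noteq> carrier_vec d"
    then obtain W where W: "invariant_subspace G d \<psi> W" "W \<noteq> {0\<^sub>v d}" "W \<noteq> carrier_vec d"
      by blast
    obtain k l A B where kl: "k < d" "l < d" and A: "A \<in> carrier_mat d k" and B: "B \<in> carrier_mat d l"
      and AA: "adj A * A = 1\<^sub>m k" and BB: "adj B * B = 1\<^sub>m l"
      and sum1: "A * adj A + B * adj B = 1\<^sub>m d"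
      and inv: "\<And>g. g \<in> carrier G \<Longrightarrow> \<psi> g * A = A * (adj A * (\<psi> g * A))"
        "\<And>g. g \<in> carrier G \<Longrightarrow> \<psi> g * B = B * (adj B * (\<psi> g * B))"
      by (rule unitary_rep_split[OF G \<psi> W]) (rule that; assumption)
    have CVc: "C * V \<in> carrier_mat n d" using C V by auto
    have "C * V = C * V * (A * adj A + B * adj B)" unfolding sum1 right_mult_one_mat[OF CVc] ..
    also have "\<dots> = C * V * (A * adj A) + C * V * (B * adj B)"
      using CVc A B by (intro mult_add_distrib_mat[of _ n d]) auto
    also have "C * V * (A * adj A) = C * V * A * adj A"
      using CVc A by (intro assoc_mult_mat[of _ n d _ k, symmetric]) auto
    also have "C * V * (B * adj B) = C * V * B * adj B"
      using CVc B by (intro assoc_mult_mat[of _ n d _ l, symmetric]) auto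
    also have "C * V * A = 0\<^sub>m n k" by (rule sub[OF kl(1) A AA inv(1)])
    also have "C * V * B = 0\<^sub>m n l" by (rule sub[OF kl(2) B BB inv(2)])
    finally have "C * V = 0\<^sub>m n d" using A B by simp
    with CV show False by simp
  qed
  with that V \<psi> int CV show thesis by blast
qed

section \<open>Multiplicities\<close>

text \<open>With $Q$ the orthogonal projection onto the span of $v$ and $w$, the claim is
  $0 \le \|P - Q\|^2 = \mathrm{tr}\,P - 2$ for the Hilbert-Schmidt norm.\<close>

lemma trace_two_fixed_vectors:
  fixes P :: "'i \<Rightarrow> 'i \<Rightarrow> complex"
  assumes I: "finite I"
    and herm: "\<And>i j. i \<in> I \<Longrightarrow> j \<in> I \<Longrightarrow> P j i = cnj (P i j)"
    and idem: "\<And>i k. i \<in> I \<Longrightarrow> k \<in> I \<Longrightarrow> (\<Sum>j\<in>I. P i j * P j k) = P i k"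
    and Pv: "\<And>i. i \<in> I \<Longrightarrow> (\<Sum>j\<in>I. P i j * v j) = v i"
    and Pw: "\<And>i. i \<in> I \<Longrightarrow> (\<Sum>j\<in>I. P i j * w j) = w i"
    and orth: "(\<Sum>i\<in>I. cnj (v i) * w i) = 0"
    and nz: "\<exists>i\<in>I. v i \<noteq> 0" "\<exists>i\<in>I. w i \<noteq> 0"
  shows "2 \<le> Re (\<Sum>i\<in>I. P i i)"
proof -
  define nv where "nv = (\<Sum>i\<in>I. cnj (v i) * v i)"
  define nw where "nw = (\<Sum>i\<in>I. cnj (w i) * w i)"
  have norm_nz: "(\<Sum>i\<in>I. cnj (f i) * f i) \<noteq> 0" if "\<exists>i\<in>I. f i \<noteq> 0" for f :: "'i \<Rightarrow> complex"
  proof -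
    from that obtain i where i: "i \<in> I" "f i \<noteq> 0" by blast
    have "0 < (\<Sum>i\<in>I. (cmod (f i))\<^sup>2)" using i I by (intro sum_pos2[of _ i]) auto
    moreover have "(\<Sum>i\<in>I. cnj (f i) * f i) = of_real (\<Sum>i\<in>I. (cmod (f i))\<^sup>2)"
      unfolding of_real_sum by (intro sum.cong refl) (metis complex_norm_square mult.commute)
    ultimately show ?thesis by (metis less_irrefl of_real_eq_0_iff)
  qed
  have nvw: "nv \<noteq> 0" "nw \<noteq> 0" using norm_nz nz by (auto simp: nv_def nw_def)
  have orth': "(\<Sum>i\<in>I. cnj (w i) * v i) = 0"
    using arg_cong[OF orth, of cnj] by (simp add: mult.commute)
  have cnj_n: "cnj nv = nv" "cnj nw = nw" by (simp_all add: nv_def nw_def mult.commute)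
  define Q where "Q i j = v i * cnj (v j) / nv + w i * cnj (w j) / nw" for i j
  have Qv: "(\<Sum>j\<in>I. Q i j * v j) = v i" for i
  proof -
    have "(\<Sum>j\<in>I. Q i j * v j) =
      v i / nv * (\<Sum>j\<in>I. cnj (v j) * v j) + w i / nw * (\<Sum>j\<in>I. cnj (w j) * v j)"
      by (simp add: Q_def sum_distrib_left sum.distrib[symmetric] algebra_simps)
    then show ?thesis using nvw by (simp add: orth' flip: nv_def)
  qed
  have Qw: "(\<Sum>j\<in>I. Q i j * w j) = w i" for i
  proof -
    have "(\<Sum>j\<in>I. Q i j * w j) =
      v i / nv * (\<Sum>j\<in>I. cnj (v j) * w j) + w i / nw * (\<Sum>j\<in>I. cnj (w j) * w j)"
      by (simp add: Q_def sum_distrib_left sum.distrib[symmetric] algebra_simps)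
    then show ?thesis using nvw by (simp add: orth flip: nw_def)
  qed
  \<comment> \<open>The Hilbert-Schmidt product of \<open>R\<close> with \<open>Q\<close> depends
    only on the values of \<open>R\<close> at v and w. Taking \<open>R\<close> to be
    \<open>P\<close> and \<open>Q\<close> evaluates both the mixed terms and the squared norm of
    \<open>Q\<close>.\<close>
  have inner_Q: "(\<Sum>i\<in>I. \<Sum>j\<in>I. R i j * cnj (Q i j)) = 2"
    if Rv: "\<And>i. i \<in> I \<Longrightarrow> (\<Sum>j\<in>I. R i j * v j) = v i"
      and Rw: "\<And>i. i \<in> I \<Longrightarrow> (\<Sum>j\<in>I. R i j * w j) = w i" for R
  proof -
    have "(\<Sum>j\<in>I. R i j * cnj (Q i j)) = cnj (v i) * v i / nv + cnj (w i) * w i / nw"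
      if i: "i \<in> I" for i
    proof -
      have "(\<Sum>j\<in>I. R i j * cnj (Q i j)) =
        cnj (v i) / nv * (\<Sum>j\<in>I. R i j * v j) + cnj (w i) / nw * (\<Sum>j\<in>I. R i j * w j)"
        by (simp add: Q_def cnj_n sum_distrib_left sum.distrib[symmetric] algebra_simps)
      then show ?thesis by (simp add: Rv[OF i] Rw[OF i])
    qed
    then have "(\<Sum>i\<in>I. \<Sum>j\<in>I. R i j * cnj (Q i j)) =
      (\<Sum>i\<in>I. cnj (v i) * v i / nv + cnj (w i) * w i / nw)"
      by (rule sum.cong[OF refl])
    also have "\<dots> = nv / nv + nw / nw"
      unfolding sum.distrib sum_divide_distrib[symmetric] nv_def[symmetric] nw_def[symmetric] ..
    finally show ?thesis using nvw by simp
  qed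
  have PP: "(\<Sum>i\<in>I. \<Sum>j\<in>I. P i j * cnj (P i j)) = (\<Sum>i\<in>I. P i i)"
    by (intro sum.cong refl) (simp add: idem flip: herm)
  have QP: "(\<Sum>i\<in>I. \<Sum>j\<in>I. Q i j * cnj (P i j)) = 2"
    using arg_cong[OF inner_Q[of P, OF Pv Pw], of cnj] by (simp add: mult.commute)
  have "(\<Sum>i\<in>I. \<Sum>j\<in>I. (P i j - Q i j) * cnj (P i j - Q i j)) = (\<Sum>i\<in>I. P i i) - 2 - 2 + 2"
    unfolding PP[symmetric] QP[symmetric]
    using inner_Q[of P, OF Pv Pw] inner_Q[of Q, OF Qv Qw] QP
    by (simp add: algebra_simps sum.distrib sum_subtractf)
  moreover have "(\<Sum>i\<in>I. \<Sum>j\<in>I. (P i j - Q i j) * cnj (P i j - Q i j)) =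
      of_real (\<Sum>i\<in>I. \<Sum>j\<in>I. (cmod (P i j - Q i j))\<^sup>2)"
    unfolding of_real_sum complex_norm_square ..
  ultimately have "Re (\<Sum>i\<in>I. P i i) - 2 = (\<Sum>i\<in>I. \<Sum>j\<in>I. (cmod (P i j - Q i j))\<^sup>2)"
    by (metis (no_types, lifting) Re_complex_of_real add_diff_cancel_right' diff_add_cancel
        minus_complex.simps(1) complex_Re_numeral)
  also have "\<dots> \<ge> 0" by (intro sum_nonneg) auto
  finally show ?thesis by simp
qed

text \<open>Averaging X \<mapsto> \<tau>(h) X \<psi>(h)^* over the group is an orthogonal projection
  on the n by d matrices. It fixes every intertwiner, and its trace is, up to conjugation, the inner
  product of the two characters. Two orthogonal nonzero intertwiners therefore force this trace to
  be at least 2.\<close>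

lemma two_intertwiners:
  fixes H (structure)
  assumes H: "group H" and fin: "finite (carrier H)"
    and \<tau>: "unitary_rep H n \<tau>" and \<psi>: "unitary_rep H d \<psi>"
    and T: "T \<in> carrier_mat n d" "T \<noteq> 0\<^sub>m n d" "\<And>h. h \<in> carrier H \<Longrightarrow> \<tau> h * T = T * \<psi> h"
    and U: "U \<in> carrier_mat n d" "U \<noteq> 0\<^sub>m n d" "\<And>h. h \<in> carrier H \<Longrightarrow> \<tau> h * U = U * \<psi> h"
    and orth: "mat_trace (adj T * U) = 0"
  shows "2 \<le> Re ((\<Sum>h\<in>carrier H. mat_trace (\<psi> h) * cnj (mat_trace (\<tau> h))) / of_nat (card (carrier H)))"
proof -
  interpret group H by fact
  note \<tau>D = unitary_repD[OF \<tau>] and \<psi>D = unitary_repD[OF \<psi>]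
  define I where "I = {..<n} \<times> {..<d}"
  define c where "c = (of_nat (card (carrier H)) :: complex)"
  have c: "c \<noteq> 0" "cnj c = c"
    using fin by (auto simp: c_def card_eq_0_iff)
  \<comment> \<open>The matrix of X \<mapsto> \<tau>(h) X \<psi>(h)^* in the basis of matrix units,
    rows and columns being indexed by pairs; \<open>P\<close> is its average over the group.\<close>
  define K where "K h p q = \<tau> h $$ (fst p, fst q) * cnj (\<psi> h $$ (snd p, snd q))" for h p q
  define P where "P p q = (\<Sum>h\<in>carrier H. K h p q) / c" for p q
  have dims: "dim_row (\<tau> h) = n" "dim_col (\<tau> h) = n" "dim_row (\<psi> h) = d" "dim_col (\<psi> h) = d"
    if "h \<in> carrier H" for h using \<tau>D(1)[OF that] \<psi>D(1)[OF that] by auto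
  have K_inv: "K (inv h) q p = cnj (K h p q)" if "h \<in> carrier H" "p \<in> I" "q \<in> I" for h p q
    using that dims[of h] by (auto simp: K_def I_def dims simp flip: \<tau>D(4) \<psi>D(4))
  have K_mult: "(\<Sum>q\<in>I. K g p q * K h q r) = K (g \<otimes> h) p r"
    if "g \<in> carrier H" "h \<in> carrier H" "p \<in> I" "r \<in> I" for g h p r
  proof -
    have "(\<Sum>q\<in>I. K g p q * K h q r) =
      (\<Sum>i<n. \<Sum>j<d. (\<tau> g $$ (fst p, i) * \<tau> h $$ (i, fst r)) *
        cnj (\<psi> g $$ (snd p, j) * \<psi> h $$ (j, snd r)))"
      unfolding I_def by (subst sum.cartesian_product) (auto simp: K_def intro!: sum.cong)
    also have "\<dots> = (\<Sum>i<n. \<tau> g $$ (fst p, i) * \<tau> h $$ (i, fst r)) *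
        cnj (\<Sum>j<d. \<psi> g $$ (snd p, j) * \<psi> h $$ (j, snd r))"
      by (simp add: sum_product)
    also have "\<dots> = K (g \<otimes> h) p r"
      using that dims[of g] dims[of h]
      by (auto simp: K_def I_def \<tau>D(3) \<psi>D(3) scalar_prod_def lessThan_atLeast0)
    finally show ?thesis .
  qed
  have K_fix: "(\<Sum>q\<in>I. K h p q * X $$ q) = X $$ p"
    if X: "X \<in> carrier_mat n d" "\<tau> h * X = X * \<psi> h" and h: "h \<in> carrier H" and p: "p \<in> I" for X h p
  proof -
    have one: "\<psi> h * adj (\<psi> h) = 1\<^sub>m d"
      using \<psi>D(3)[of h "inv h"] h by (simp add: \<psi>D(2,4))
    have "(\<Sum>q\<in>I. K h p q * X $$ q) =
      (\<Sum>i<n. \<tau> h $$ (fst p, i) * (\<Sum>j<d. X $$ (i, j) * cnj (\<psi> h $$ (snd p, j))))"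
      unfolding I_def sum_distrib_left
      by (subst sum.cartesian_product) (auto simp: K_def intro!: sum.cong)
    also have "\<dots> = (\<tau> h * (X * adj (\<psi> h))) $$ p"
      using X(1) dims[OF h] p by (auto simp: I_def scalar_prod_def lessThan_atLeast0)
    also have "\<tau> h * (X * adj (\<psi> h)) = X * \<psi> h * adj (\<psi> h)"
      using X \<tau>D(1)[OF h] \<psi>D(1)[OF h] by (simp add: assoc_mult_mat[of _ n n _ d _ d, symmetric])
    also have "\<dots> = X"
      using X \<psi>D(1)[OF h] one by (simp add: assoc_mult_mat[of _ n d _ d _ d])
    finally show ?thesis .
  qed
  have P_fix: "(\<Sum>q\<in>I. P p q * X $$ q) = X $$ p"
    if X: "X \<in> carrier_mat n d" "\<And>h. h \<in> carrier H \<Longrightarrow> \<tau> h * X = X * \<psi> h" and p: "p \<in> I" for X p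
  proof -
    have "(\<Sum>q\<in>I. P p q * X $$ q) = (\<Sum>h\<in>carrier H. \<Sum>q\<in>I. K h p q * X $$ q) / c"
      by (subst sum.swap) (simp add: P_def sum_divide_distrib sum_distrib_right)
    also have "\<dots> = X $$ p"
      using c X p by (simp add: K_fix c_def)
    finally show ?thesis .
  qed
  have translate: "(\<Sum>h\<in>carrier H. f (g \<otimes> h)) = sum f (carrier H)" if "g \<in> carrier H"
    for g and f :: "_ \<Rightarrow> complex"
    by (rule sum.reindex_bij_witness[of _ "\<lambda>h. inv g \<otimes> h" "\<lambda>h. g \<otimes> h"])
      (use that in \<open>auto simp: inv_solve_left' m_assoc[symmetric]\<close>)
  have "2 \<le> Re (\<Sum>p\<in>I. P p p)"
  proof (rule trace_two_fixed_vectors[of I P "\<lambda>p. T $$ p" "\<lambda>p. U $$ p"])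
    show "finite I" by (simp add: I_def)
    fix p q assume pq: "p \<in> I" "q \<in> I"
    have "(\<Sum>h\<in>carrier H. K h q p) = (\<Sum>h\<in>carrier H. K (inv h) q p)"
      by (rule sum.reindex_bij_witness[of _ "\<lambda>h. inv h" "\<lambda>h. inv h"]) auto
    then show "P q p = cnj (P p q)" using c K_inv pq by (simp add: P_def)
    have "(\<Sum>r\<in>I. P p r * P r q) = (\<Sum>r\<in>I. \<Sum>g\<in>carrier H. \<Sum>h\<in>carrier H. K g p r * K h r q / (c * c))"
      by (simp add: P_def sum_product sum_divide_distrib)
    also have "\<dots> = (\<Sum>g\<in>carrier H. \<Sum>h\<in>carrier H. \<Sum>r\<in>I. K g p r * K h r q / (c * c))"
      by (subst sum.swap, intro sum.cong refl, subst sum.swap) simp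
    also have "\<dots> = (\<Sum>g\<in>carrier H. \<Sum>h\<in>carrier H. K (g \<otimes> h) p q / (c * c))"
      using K_mult pq by (intro sum.cong refl) (simp flip: sum_divide_distrib)
    also have "\<dots> = (\<Sum>g\<in>carrier H. \<Sum>h\<in>carrier H. K h p q / (c * c))"
      by (rule sum.cong[OF refl], rule translate)
    also have "\<dots> = P p q" using c by (simp add: P_def flip: sum_divide_distrib c_def)
    finally show "(\<Sum>r\<in>I. P p r * P r q) = P p q" .
  next
    have "mat_trace (adj T * U) = (\<Sum>j<d. \<Sum>i<n. cnj (T $$ (i, j)) * U $$ (i, j))"
      using T(1) U(1) by (simp add: mat_trace_def scalar_prod_def lessThan_atLeast0)
    also have "\<dots> = (\<Sum>p\<in>I. cnj (T $$ p) * U $$ p)"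
      unfolding I_def by (subst sum.swap) (simp add: sum.cartesian_product)
    finally show "(\<Sum>p\<in>I. cnj (T $$ p) * U $$ p) = 0" using orth by simp
    have "\<exists>p\<in>I. X $$ p \<noteq> 0" if "X \<in> carrier_mat n d" "X \<noteq> 0\<^sub>m n d" for X :: "complex mat"
      using that by (auto simp: I_def)
    with T U show "\<exists>p\<in>I. T $$ p \<noteq> 0" "\<exists>p\<in>I. U $$ p \<noteq> 0" by blast+
  qed (use T U P_fix in auto)
  also have "(\<Sum>p\<in>I. P p p) = (\<Sum>h\<in>carrier H. \<Sum>p\<in>I. K h p p) / c"
    by (subst sum.swap) (simp add: P_def sum_divide_distrib)
  also have "(\<Sum>h\<in>carrier H. \<Sum>p\<in>I. K h p p) = (\<Sum>h\<in>carrier H. mat_trace (\<tau> h) * cnj (mat_trace (\<psi> h)))"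
    by (intro sum.cong refl)
      (simp add: K_def I_def mat_trace_def dims sum_product sum.cartesian_product case_prod_beta)
  \<comment> \<open>The trace of \<open>P\<close> has the conjugate on the other character; only its
    real part matters.\<close>
  also have "\<dots> / c = cnj ((\<Sum>h\<in>carrier H. mat_trace (\<psi> h) * cnj (mat_trace (\<tau> h))) / c)"
    using c by (simp add: mult.commute)
  finally show ?thesis by (simp add: c_def)
qed

section \<open>Class sums and strong Gelfand pairs\<close>

text \<open>Frobenius reciprocity for a class function \<chi>: the substitution of xyx^-1 for g
  shows that every x in the formula for the induced function contributes the same sum over H, and
  the |G| equal terms cancel the denominator of the inner product.\<close>

lemma char_inner_induce:
  fixes G (structure)
  assumes G: "group G" "finite (carrier G)" and H: "subgroup H G"
    and \<chi>: "\<And>x y. x \<in> carrier G \<Longrightarrow> y \<in> carrier G \<Longrightarrow> \<chi> (x \<otimes> y \<otimes> inv x) = \<chi> y"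
  shows "char_inner G (induce G H \<psi>) \<chi> = (\<Sum>h\<in>H. \<psi> h * cnj (\<chi> h)) / of_nat (card H)"
proof -
  interpret group G by fact
  let ?c = "of_nat (card H) :: complex"
  define f where "f y = (if y \<in> H then \<psi> y else 0)" for y
  have Hs: "H \<subseteq> carrier G" using H by (rule subgroup.subset)
  have conj: "(\<Sum>g\<in>carrier G. f (inv x \<otimes> g \<otimes> x) * cnj (\<chi> g)) = (\<Sum>h\<in>H. \<psi> h * cnj (\<chi> h))"
    if x: "x \<in> carrier G" for x
  proof -
    have "(\<Sum>g\<in>carrier G. f (inv x \<otimes> g \<otimes> x) * cnj (\<chi> g)) = (\<Sum>y\<in>carrier G. f y * cnj (\<chi> y))"
    proof (rule sum.reindex_bij_witness[of _ "\<lambda>y. x \<otimes> y \<otimes> inv x" "\<lambda>g. inv x \<otimes> g \<otimes> x"])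
      fix g assume g: "g \<in> carrier G"
      show *: "x \<otimes> (inv x \<otimes> g \<otimes> x) \<otimes> inv x = g"
        using x g by (simp add: m_assoc) (simp flip: m_assoc)
      show "inv x \<otimes> (x \<otimes> g \<otimes> inv x) \<otimes> x = g"
        using x g by (simp add: m_assoc) (simp flip: m_assoc)
      show "f (inv x \<otimes> g \<otimes> x) * cnj (\<chi> (inv x \<otimes> g \<otimes> x)) = f (inv x \<otimes> g \<otimes> x) * cnj (\<chi> g)"
        using \<chi>[of x "inv x \<otimes> g \<otimes> x"] x g * by simp
    qed (use x in auto)
    also have "\<dots> = (\<Sum>h\<in>H. f h * cnj (\<chi> h))"
      using G(2) Hs by (intro sum.mono_neutral_right) (auto simp: f_def)
    also have "\<dots> = (\<Sum>h\<in>H. \<psi> h * cnj (\<chi> h))" by (simp add: f_def)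
    finally show ?thesis .
  qed
  have "(\<Sum>g\<in>carrier G. induce G H \<psi> g * cnj (\<chi> g)) =
    (\<Sum>g\<in>carrier G. \<Sum>x\<in>carrier G. f (inv x \<otimes> g \<otimes> x) * cnj (\<chi> g) / ?c)"
    by (intro sum.cong refl)
      (simp add: induce_def Let_def f_def sum_distrib_right flip: sum_divide_distrib)
  also have "\<dots> = (\<Sum>x\<in>carrier G. (\<Sum>g\<in>carrier G. f (inv x \<otimes> g \<otimes> x) * cnj (\<chi> g)) / ?c)"
    by (subst sum.swap) (simp add: sum_divide_distrib)
  also have "\<dots> = of_nat (card (carrier G)) * ((\<Sum>h\<in>H. \<psi> h * cnj (\<chi> h)) / ?c)"
    by (simp add: conj)
  finally show ?thesis
    using G(2) by (auto simp: char_inner_def card_eq_0_iff)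
qed

text \<open>The image under \<open>\<rho>\<close> of the group algebra element that sums hxh^-1 over
  all h in \<open>H\<close>. Each H-conjugate of x is counted as often as the order of the
  centraliser of x in \<open>H\<close>.\<close>

definition class_sum ::
  "('g, 'm) monoid_scheme \<Rightarrow> 'g set \<Rightarrow> nat \<Rightarrow> ('g \<Rightarrow> complex mat) \<Rightarrow> 'g \<Rightarrow> complex mat" where
  "class_sum G H n \<rho> x =
     mat n n (\<lambda>(i, j). \<Sum>h\<in>H. \<rho> (h \<otimes>\<^bsub>G\<^esub> x \<otimes>\<^bsub>G\<^esub> inv\<^bsub>G\<^esub> h) $$ (i, j))"

lemma class_sum_carrier [simp]: "class_sum G H n \<rho> x \<in> carrier_mat n n"
  by (simp add: class_sum_def)

lemma class_sum_dim [simp]: "dim_row (class_sum G H n \<rho> x) = n" "dim_col (class_sum G H n \<rho> x) = n"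
  by (simp_all add: class_sum_def)

context
  fixes G (structure) and H :: "'g set"
  assumes G: "group G" and H: "subgroup H G"
begin

interpretation group G by (rule G)

lemma conj_closed: "h \<in> H \<Longrightarrow> x \<in> carrier G \<Longrightarrow> h \<otimes> x \<otimes> inv h \<in> carrier G"
  using subgroup.mem_carrier[OF H] by auto

lemma class_sum_intertwine:
  assumes \<rho>: "unitary_rep G n \<rho>" and \<psi>: "unitary_rep G d \<psi>" and V: "V \<in> carrier_mat n d"
    and int: "\<And>g. g \<in> carrier G \<Longrightarrow> \<rho> g * V = V * \<psi> g"
    and x: "x \<in> carrier G"
  shows "class_sum G H n \<rho> x * V = V * class_sum G H d \<psi> x"
proof (rule eq_matI)
  fix i j assume "i < dim_row (V * class_sum G H d \<psi> x)" "j < dim_col (V * class_sum G H d \<psi> x)"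
  then have ij: "i < n" "j < d" using V by auto
  have dims: "dim_row (\<rho> g) = n" "dim_col (\<rho> g) = n" "dim_row (\<psi> g) = d" "dim_col (\<psi> g) = d"
    if "g \<in> carrier G" for g
    using unitary_repD(1)[OF \<rho> that] unitary_repD(1)[OF \<psi> that] by auto
  have "(class_sum G H n \<rho> x * V) $$ (i, j) =
      (\<Sum>k<n. \<Sum>h\<in>H. \<rho> (h \<otimes> x \<otimes> inv h) $$ (i, k) * V $$ (k, j))"
    using V ij by (simp add: class_sum_def scalar_prod_def lessThan_atLeast0 sum_distrib_right)
  also have "\<dots> = (\<Sum>h\<in>H. (\<rho> (h \<otimes> x \<otimes> inv h) * V) $$ (i, j))"
    by (subst sum.swap, intro sum.cong refl)
      (use V ij x dims in \<open>simp add: scalar_prod_def lessThan_atLeast0 conj_closed\<close>)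
  also have "\<dots> = (\<Sum>h\<in>H. (V * \<psi> (h \<otimes> x \<otimes> inv h)) $$ (i, j))"
    using x by (simp add: int conj_closed)
  also have "\<dots> = (\<Sum>h\<in>H. \<Sum>k<d. V $$ (i, k) * \<psi> (h \<otimes> x \<otimes> inv h) $$ (k, j))"
    by (intro sum.cong refl)
      (use V ij x dims in \<open>simp add: scalar_prod_def lessThan_atLeast0 conj_closed\<close>)
  also have "\<dots> = (V * class_sum G H d \<psi> x) $$ (i, j)"
    by (subst sum.swap)
      (use V ij in \<open>simp add: class_sum_def scalar_prod_def lessThan_atLeast0 sum_distrib_left\<close>)
  finally show "(class_sum G H n \<rho> x * V) $$ (i, j) = (V * class_sum G H d \<psi> x) $$ (i, j)" .
qed (use V in auto)

text \<open>Conjugation by y only permutes the summands, by the substitution of yh for h.\<close>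

lemma class_sum_commute:
  assumes \<rho>: "unitary_rep G n \<rho>" and x: "x \<in> carrier G" and y: "y \<in> H"
  shows "\<rho> y * class_sum G H n \<rho> x = class_sum G H n \<rho> x * \<rho> y"
proof (rule eq_matI)
  note \<rho>D = unitary_repD[OF \<rho>]
  have yc: "y \<in> carrier G" using y H by (rule subgroup.mem_carrier[rotated])
  have dims: "dim_row (\<rho> g) = n" "dim_col (\<rho> g) = n" if "g \<in> carrier G" for g
    using \<rho>D(1)[OF that] by auto
  fix i j assume "i < dim_row (class_sum G H n \<rho> x * \<rho> y)" "j < dim_col (class_sum G H n \<rho> x * \<rho> y)"
  then have ij: "i < n" "j < n" using dims yc by auto
  have "(\<rho> y * class_sum G H n \<rho> x) $$ (i, j) =
      (\<Sum>k<n. \<Sum>h\<in>H. \<rho> y $$ (i, k) * \<rho> (h \<otimes> x \<otimes> inv h) $$ (k, j))"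
    using ij yc dims by (simp add: class_sum_def scalar_prod_def lessThan_atLeast0 sum_distrib_left)
  also have "\<dots> = (\<Sum>h\<in>H. \<rho> (y \<otimes> (h \<otimes> x \<otimes> inv h)) $$ (i, j))"
    by (subst sum.swap, intro sum.cong refl)
      (use ij x yc dims in \<open>simp add: \<rho>D(3) scalar_prod_def lessThan_atLeast0 conj_closed\<close>)
  also have "\<dots> = (\<Sum>h\<in>H. \<rho> ((h \<otimes> x \<otimes> inv h) \<otimes> y) $$ (i, j))"
  proof (rule sum.reindex_bij_witness[of _ "\<lambda>h. inv y \<otimes> h" "\<lambda>h. y \<otimes> h"])
    fix h assume h: "h \<in> H"
    then have hc: "h \<in> carrier G" using H by (rule subgroup.mem_carrier[rotated])
    show "inv y \<otimes> (y \<otimes> h) = h" "y \<otimes> (inv y \<otimes> h) = h"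
      using yc hc by (simp_all flip: m_assoc)
    show "y \<otimes> h \<in> H" "inv y \<otimes> h \<in> H"
      using H h y by (auto intro: subgroup.m_closed subgroup.m_inv_closed)
    show "\<rho> (y \<otimes> h \<otimes> x \<otimes> inv (y \<otimes> h) \<otimes> y) $$ (i, j) = \<rho> (y \<otimes> (h \<otimes> x \<otimes> inv h)) $$ (i, j)"
      using yc hc x by (simp add: inv_mult_group m_assoc)
  qed
  also have "\<dots> = (\<Sum>h\<in>H. \<Sum>k<n. \<rho> (h \<otimes> x \<otimes> inv h) $$ (i, k) * \<rho> y $$ (k, j))"
    by (intro sum.cong refl)
      (use ij x yc dims in \<open>simp add: \<rho>D(3) scalar_prod_def lessThan_atLeast0 conj_closed\<close>)
  also have "\<dots> = (class_sum G H n \<rho> x * \<rho> y) $$ (i, j)"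
    by (subst sum.swap)
      (use ij yc dims in \<open>simp add: class_sum_def scalar_prod_def lessThan_atLeast0 sum_distrib_right\<close>)
  finally show "(\<rho> y * class_sum G H n \<rho> x) $$ (i, j) = (class_sum G H n \<rho> x * \<rho> y) $$ (i, j)" .
next
  have yc: "y \<in> carrier G" using y H by (rule subgroup.mem_carrier[rotated])
  show "dim_row (\<rho> y * class_sum G H n \<rho> x) = dim_row (class_sum G H n \<rho> x * \<rho> y)"
    "dim_col (\<rho> y * class_sum G H n \<rho> x) = dim_col (class_sum G H n \<rho> x * \<rho> y)"
    using unitary_repD(1)[OF \<rho> yc] by auto
qed

lemma class_sum_mult_index:
  assumes \<rho>: "unitary_rep G n \<rho>" and x: "x \<in> carrier G" "y \<in> carrier G" and ij: "i < n" "j < n"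
  shows "(class_sum G H n \<rho> x * class_sum G H n \<rho> y) $$ (i, j) =
    (\<Sum>h\<in>H. \<Sum>h'\<in>H. \<rho> ((h \<otimes> x \<otimes> inv h) \<otimes> (h' \<otimes> y \<otimes> inv h')) $$ (i, j))"
proof -
  note \<rho>D = unitary_repD[OF \<rho>]
  have dims: "dim_row (\<rho> g) = n" "dim_col (\<rho> g) = n" if "g \<in> carrier G" for g
    using \<rho>D(1)[OF that] by auto
  have "(class_sum G H n \<rho> x * class_sum G H n \<rho> y) $$ (i, j) =
    (\<Sum>k<n. \<Sum>h\<in>H. \<Sum>h'\<in>H. \<rho> (h \<otimes> x \<otimes> inv h) $$ (i, k) * \<rho> (h' \<otimes> y \<otimes> inv h') $$ (k, j))"
    using ij by (simp add: class_sum_def scalar_prod_def lessThan_atLeast0 sum_product)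
  also have "\<dots> = (\<Sum>h\<in>H. \<Sum>h'\<in>H. \<Sum>k<n. \<rho> (h \<otimes> x \<otimes> inv h) $$ (i, k) * \<rho> (h' \<otimes> y \<otimes> inv h') $$ (k, j))"
    by (subst sum.swap, rule sum.cong[OF refl], rule sum.swap)
  also have "\<dots> = (\<Sum>h\<in>H. \<Sum>h'\<in>H. \<rho> ((h \<otimes> x \<otimes> inv h) \<otimes> (h' \<otimes> y \<otimes> inv h')) $$ (i, j))"
    by (intro sum.cong refl)
      (use ij x dims in \<open>simp add: \<rho>D(3) scalar_prod_def lessThan_atLeast0 conj_closed\<close>)
  finally show ?thesis .
qed

end

section \<open>The regular representation\<close>

definition regular_rep :: "('g, 'm) monoid_scheme \<Rightarrow> (nat \<Rightarrow> 'g) \<Rightarrow> 'g \<Rightarrow> complex mat" where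
  "regular_rep G e g = mat (card (carrier G)) (card (carrier G))
     (\<lambda>(i, j). if e i = g \<otimes>\<^bsub>G\<^esub> e j then 1 else 0)"

lemma unitary_regular_rep:
  fixes G (structure)
  assumes G: "group G" and e: "bij_betw e {..<card (carrier G)} (carrier G)"
  shows "unitary_rep G (card (carrier G)) (regular_rep G e)"
proof -
  interpret group G by fact
  define N where "N = card (carrier G)"
  have eN: "bij_betw e {..<N} (carrier G)" using e by (simp add: N_def)
  have e_in: "e i \<in> carrier G" if "i < N" for i using bij_betwE[OF eN] that by auto
  have e_eq: "e i = e j \<longleftrightarrow> i = j" if "i < N" "j < N" for i j
    using bij_betw_imp_inj_on[OF eN] that by (auto dest: inj_onD)
  have fin: "finite (carrier G)" using eN bij_betw_finite by blast
  have idx: "regular_rep G e g $$ (i, j) = (if e i = g \<otimes> e j then 1 else 0)" if "i < N" "j < N" for g i j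
    using that by (simp add: regular_rep_def N_def)
  have car: "regular_rep G e g \<in> carrier_mat N N" for g by (simp add: regular_rep_def N_def)
  then have dims [simp]: "dim_row (regular_rep G e g) = N" "dim_col (regular_rep G e g) = N" for g
    by auto
  show ?thesis
    unfolding unitary_rep_def is_rep_def N_def[symmetric]
  proof (intro conjI ballI)
    fix g assume g: "g \<in> carrier G"
    show "adj (regular_rep G e g) = regular_rep G e (inv g)"
    proof (rule eq_matI)
      fix i j assume "i < dim_row (regular_rep G e (inv g))" "j < dim_col (regular_rep G e (inv g))"
      then show "adj (regular_rep G e g) $$ (i, j) = regular_rep G e (inv g) $$ (i, j)"
        using g e_in[of i] e_in[of j] by (auto simp: idx simp flip: m_assoc)
    qed auto
    fix h assume h: "h \<in> carrier G"
    show "regular_rep G e (g \<otimes> h) = regular_rep G e g * regular_rep G e h"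
    proof (rule eq_matI)
      fix i j assume "i < dim_row (regular_rep G e g * regular_rep G e h)"
        "j < dim_col (regular_rep G e g * regular_rep G e h)"
      then have ij: "i < N" "j < N" by auto
      have "(regular_rep G e g * regular_rep G e h) $$ (i, j) =
        (\<Sum>k<N. (if e i = g \<otimes> e k then 1 else 0) * (if e k = h \<otimes> e j then 1 else 0))"
        using ij by (simp add: scalar_prod_def lessThan_atLeast0 idx)
      also have "\<dots> = (\<Sum>y\<in>carrier G. (if e i = g \<otimes> y then 1 else 0) * (if y = h \<otimes> e j then 1 else 0))"
        by (rule sum.reindex_bij_betw[OF eN])
      also have "\<dots> = (\<Sum>y\<in>carrier G. if y = h \<otimes> e j then (if e i = g \<otimes> y then 1 else 0) else 0)"
        by (intro sum.cong) auto
      also have "\<dots> = regular_rep G e (g \<otimes> h) $$ (i, j)"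
        using ij g h fin e_in[of j] by (simp add: idx m_assoc)
      finally show "regular_rep G e (g \<otimes> h) $$ (i, j) = (regular_rep G e g * regular_rep G e h) $$ (i, j)" ..
    qed auto
  next
    show "regular_rep G e \<one> = 1\<^sub>m N"
      by (rule eq_matI) (auto simp: idx e_in e_eq)
  qed (rule car)
qed

lemma trace_rep_conj:
  fixes G (structure)
  assumes G: "group G" and \<rho>: "unitary_rep G n \<rho>" and x: "x \<in> carrier G" "y \<in> carrier G"
  shows "mat_trace (\<rho> (x \<otimes> y \<otimes> inv x)) = mat_trace (\<rho> y)"
proof -
  interpret group G by fact
  note \<rho>D = unitary_repD[OF \<rho>]
  have "mat_trace (\<rho> ((x \<otimes> y) \<otimes> inv x)) = mat_trace (\<rho> (inv x \<otimes> (x \<otimes> y)))"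
    using x trace_mult_comm[OF \<rho>D(1)[of "x \<otimes> y"] \<rho>D(1)[of "inv x"]]
    by (simp only: \<rho>D(3) m_closed inv_closed)
  also have "inv x \<otimes> (x \<otimes> y) = y" using x by (simp flip: m_assoc)
  finally show ?thesis .
qed

text \<open>Restricted to \<open>H\<close>, \<open>\<tau>\<close> has an irreducible constituent
  \<open>V\<close> on which the commutator of \<open>A\<close> and \<open>B\<close> does not vanish.
  Multiplicity one makes every matrix commuting with \<open>\<tau>\<close> on \<open>H\<close> act
  on \<open>V\<close> as a scalar, so \<open>A\<close> and \<open>B\<close> commute there, a
  contradiction.\<close>

lemma strong_gelfand_pair_commute:
  fixes G (structure)
  assumes G: "group G" "finite (carrier G)" and H: "subgroup H G"
    and sg: "strong_gelfand_pair G H"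
    and \<tau>: "unitary_rep G n \<tau>" "is_irrep G n \<tau>"
    and A: "A \<in> carrier_mat n n" "\<And>h. h \<in> H \<Longrightarrow> \<tau> h * A = A * \<tau> h"
    and B: "B \<in> carrier_mat n n" "\<And>h. h \<in> H \<Longrightarrow> \<tau> h * B = B * \<tau> h"
  shows "A * B = B * A"
proof (rule ccontr)
  assume neq: "A * B \<noteq> B * A"
  interpret group G by fact
  let ?K = "G\<lparr>carrier := H\<rparr>"
  have K: "group ?K" using H by (rule subgroup_imp_group)
  have Hs: "H \<subseteq> carrier G" using H by (rule subgroup.subset)
  have finH: "finite H" using Hs G(2) by (rule finite_subset)
  have inv_K: "inv\<^bsub>?K\<^esub> h = inv h" if "h \<in> H" for h
    using m_inv_consistent[OF H that] .
  have \<tau>K: "unitary_rep ?K n \<tau>"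
    using \<tau>(1) Hs by (auto simp: unitary_rep_def is_rep_def inv_K subset_iff)
  have ABc: "A * B \<in> carrier_mat n n" "B * A \<in> carrier_mat n n" using A(1) B(1) by auto
  have Cc: "A * B - B * A \<in> carrier_mat n n" by (rule minus_carrier_mat[OF ABc(2)])
  have C0: "A * B - B * A \<noteq> 0\<^sub>m n n"
  proof
    assume z: "A * B - B * A = 0\<^sub>m n n"
    have "A * B = B * A"
    proof (rule eq_matI)
      fix i j assume "i < dim_row (B * A)" "j < dim_col (B * A)"
      then have ij: "i < n" "j < n" using A(1) B(1) by auto
      have "(A * B - B * A) $$ (i, j) = 0" using z ij by simp
      then show "(A * B) $$ (i, j) = (B * A) $$ (i, j)"
        using ij ABc by (subst (asm) index_minus_mat) auto
    qed (use A(1) B(1) in auto)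
    with neq show False ..
  qed
  obtain d V \<psi>
    where V: "V \<in> carrier_mat n d" "adj V * V = 1\<^sub>m d"
      and \<psi>: "unitary_rep ?K d \<psi>" "is_irrep ?K d \<psi>"
      and int: "\<And>h. h \<in> H \<Longrightarrow> \<tau> h * V = V * \<psi> h" and CV: "(A * B - B * A) * V \<noteq> 0\<^sub>m n d"
    by (rule irreducible_constituent[OF K \<tau>K Cc C0]) (rule that; simp)
  have \<tau>c: "\<tau> h \<in> carrier_mat n n" if "h \<in> H" for h using unitary_repD(1)[OF \<tau>K] that by simp
  have \<psi>c: "\<psi> h \<in> carrier_mat d d" if "h \<in> H" for h using unitary_repD(1)[OF \<psi>(1)] that by simp
  have d: "d > 0" using \<psi>(2) by (simp add: is_irrep_def)
  have V0: "V \<noteq> 0\<^sub>m n d"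
  proof
    assume "V = 0\<^sub>m n d"
    then have "(A * B - B * A) * V = 0\<^sub>m n d" using Cc by (simp add: right_mult_zero_mat)
    with CV show False ..
  qed
  \<comment> \<open>With \<open>X\<close> also \<open>X * V\<close> is an intertwiner. The scalar is
    the coefficient of its projection onto \<open>V\<close>, whose squared norm is d; subtracting it
    leaves a \<open>T\<close> orthogonal to \<open>V\<close>. If \<open>T\<close> were nonzero,
    \<open>V\<close> and \<open>T\<close> would give multiplicity at least 2.\<close>
  have scalar: "X * V = (mat_trace (adj V * (X * V)) / of_nat d) \<cdot>\<^sub>m V"
    if X: "X \<in> carrier_mat n n" "\<And>h. h \<in> H \<Longrightarrow> \<tau> h * X = X * \<tau> h" for X
  proof (rule ccontr)
    define c where "c = mat_trace (adj V * (X * V)) / of_nat d"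
    define T where "T = X * V - c \<cdot>\<^sub>m V"
    assume ne: "X * V \<noteq> (mat_trace (adj V * (X * V)) / of_nat d) \<cdot>\<^sub>m V"
    have XV: "X * V \<in> carrier_mat n d" using X V by auto
    have T: "T \<in> carrier_mat n d" unfolding T_def using V(1) by (intro minus_carrier_mat) simp
    have T0: "T \<noteq> 0\<^sub>m n d"
    proof
      assume z: "T = 0\<^sub>m n d"
      have "X * V = c \<cdot>\<^sub>m V"
      proof (rule eq_matI)
        fix i j assume "i < dim_row (c \<cdot>\<^sub>m V)" "j < dim_col (c \<cdot>\<^sub>m V)"
        then have ij: "i < n" "j < d" using V by auto
        have "T $$ (i, j) = 0" using z ij by simp
        then show "(X * V) $$ (i, j) = (c \<cdot>\<^sub>m V) $$ (i, j)"
          unfolding T_def using ij V(1) by (subst (asm) index_minus_mat) simp_all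
      qed (use X V in auto)
      with ne show False unfolding c_def by contradiction
    qed
    have T_int: "\<tau> h * T = T * \<psi> h" if h: "h \<in> H" for h
    proof -
      have "\<tau> h * (X * V) = X * V * \<psi> h"
      proof -
        have "\<tau> h * (X * V) = \<tau> h * X * V" by (rule assoc_mult_mat[OF \<tau>c[OF h] X(1) V(1), symmetric])
        also have "\<dots> = X * (\<tau> h * V)" unfolding X(2)[OF h] by (rule assoc_mult_mat[OF X(1) \<tau>c[OF h] V(1)])
        also have "\<dots> = X * V * \<psi> h" unfolding int[OF h]
          by (rule assoc_mult_mat[OF X(1) V(1) \<psi>c[OF h], symmetric])
        finally show ?thesis .
      qed
      moreover have "\<tau> h * (c \<cdot>\<^sub>m V) = c \<cdot>\<^sub>m V * \<psi> h"
        using mult_smult_distrib[OF \<tau>c[OF h] V(1)] mult_smult_assoc_mat[OF V(1) \<psi>c[OF h]] int[OF h]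
        by simp
      moreover have "\<tau> h * T = \<tau> h * (X * V) - \<tau> h * (c \<cdot>\<^sub>m V)"
        unfolding T_def using XV V(1) by (intro mult_minus_distrib_mat[OF \<tau>c[OF h]]) auto
      moreover have "T * \<psi> h = X * V * \<psi> h - c \<cdot>\<^sub>m V * \<psi> h"
        unfolding T_def using XV V(1) \<psi>c[OF h] by (intro minus_mult_distrib_mat) auto
      ultimately show ?thesis by simp
    qed
    have "mat_trace (adj V * T) = 0"
    proof -
      have "adj V * T = adj V * (X * V) - adj V * (c \<cdot>\<^sub>m V)"
        unfolding T_def using XV V(1) by (intro mult_minus_distrib_mat[of _ d n]) auto
      also have "adj V * (c \<cdot>\<^sub>m V) = c \<cdot>\<^sub>m (1\<^sub>m d)"
        using V by (subst mult_smult_distrib[of _ d n]) auto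
      finally have "mat_trace (adj V * T) = mat_trace (adj V * (X * V)) - mat_trace (c \<cdot>\<^sub>m (1\<^sub>m d))"
        using XV V(1) by (simp add: trace_minus[of _ d])
      also have "mat_trace (c \<cdot>\<^sub>m (1\<^sub>m d)) = of_nat d * c" by (simp add: mat_trace_def)
      finally show ?thesis using d by (simp add: c_def)
    qed
    then have "2 \<le> Re ((\<Sum>h\<in>H. mat_trace (\<psi> h) * cnj (mat_trace (\<tau> h))) / of_nat (card H))"
      using two_intertwiners[OF K _ \<tau>K \<psi>(1) V(1) V0 _ T T0] finH int T_int by simp
    moreover
    define \<chi> where "\<chi> g = (if g \<in> carrier G then mat_trace (\<tau> g) else 0)" for g
    define \<phi> where "\<phi> h = (if h \<in> H then mat_trace (\<psi> h) else 0)" for h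
    have "\<phi> \<in> irr_chars ?K"
      unfolding irr_chars_def \<phi>_def using \<psi>(2) by auto
    moreover have "\<chi> \<in> irr_chars G"
      unfolding irr_chars_def \<chi>_def using \<tau>(2) by auto
    ultimately have "Re (char_inner G (induce G H \<phi>) \<chi>) \<le> 1"
      using sg unfolding strong_gelfand_pair_def by blast
    moreover have "char_inner G (induce G H \<phi>) \<chi> = (\<Sum>h\<in>H. \<phi> h * cnj (\<chi> h)) / of_nat (card H)"
      using trace_rep_conj[OF G(1) \<tau>(1)] by (intro char_inner_induce[OF G H]) (simp add: \<chi>_def)
    moreover have "(\<Sum>h\<in>H. \<phi> h * cnj (\<chi> h)) = (\<Sum>h\<in>H. mat_trace (\<psi> h) * cnj (mat_trace (\<tau> h)))"
      using Hs by (intro sum.cong) (auto simp: \<phi>_def \<chi>_def)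
    ultimately show False using \<open>2 \<le> Re _\<close> by simp
  qed
  obtain a where a: "A * V = a \<cdot>\<^sub>m V" using scalar[OF A] by blast
  obtain b where b: "B * V = b \<cdot>\<^sub>m V" using scalar[OF B] by blast
  have "A * B * V = (a * b) \<cdot>\<^sub>m V"
    using A(1) B(1) V(1) a b by (auto simp: assoc_mult_mat[OF A(1) B(1) V(1)] mult_smult_distrib[OF A(1) V(1)] intro!: eq_matI)
  moreover have "B * A * V = (a * b) \<cdot>\<^sub>m V"
    using A(1) B(1) V(1) a b by (auto simp: assoc_mult_mat[OF B(1) A(1) V(1)] mult_smult_distrib[OF B(1) V(1)] intro!: eq_matI)
  ultimately have "(A * B - B * A) * V = (a * b) \<cdot>\<^sub>m V - (a * b) \<cdot>\<^sub>m V"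
    using minus_mult_distrib_mat[OF ABc V(1)] by simp
  also have "\<dots> = 0\<^sub>m n d" using V(1) by (intro minus_r_inv_mat) auto
  finally show False using CV by simp
qed

text \<open>If no such factorisation exists, the class sums of g and k fail to commute already in
  the regular representation, since gk occurs in one product and not in the other. Some irreducible
  constituent then detects this, against \<open>strong_gelfand_pair_commute\<close>.\<close>

theorem strong_gelfand_pair_factor:
  fixes G (structure)
  assumes G: "group G" "finite (carrier G)" and H: "subgroup H G"
    and sg: "strong_gelfand_pair G H" and g: "g \<in> carrier G" and k: "k \<in> carrier G"
  shows "\<exists>x\<in>H. \<exists>y\<in>H. g \<otimes> k = (x \<otimes> k \<otimes> inv x) \<otimes> (y \<otimes> g \<otimes> inv y)"
proof (rule ccontr)
  assume neg: "\<not> ?thesis"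
  interpret group G by fact
  define N where "N = card (carrier G)"
  have Hs: "H \<subseteq> carrier G" using H by (rule subgroup.subset)
  have finH: "finite H" using Hs G(2) by (rule finite_subset)
  obtain e where e: "bij_betw e {..<N} (carrier G)"
    using ex_bij_betw_nat_finite[OF G(2)] by (auto simp: N_def lessThan_atLeast0)
  define R where "R = regular_rep G e"
  have R: "unitary_rep G N R"
    unfolding R_def N_def using unitary_regular_rep[OF G(1)] e by (simp add: N_def)
  \<comment> \<open>In the regular representation, the entry in row gk and column 1 of the image of
    a group algebra element is its coefficient at gk.\<close>
  obtain i j where i: "i < N" "e i = g \<otimes> k" and j: "j < N" "e j = \<one>"
    using bij_betw_imp_surj_on[OF e] g k by (metis imageE lessThan_iff m_closed one_closed)
  have R_ij: "R x $$ (i, j) = (if x = g \<otimes> k then 1 else 0)" if "x \<in> carrier G" for x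
    using that i j by (auto simp: R_def regular_rep_def N_def)
  let ?A = "class_sum G H N R g" and ?B = "class_sum G H N R k"
  have conj: "h \<otimes> x \<otimes> inv h \<in> carrier G" if "h \<in> H" "x \<in> carrier G" for h x
    using that Hs by auto
  have neg': "(x \<otimes> k \<otimes> inv x) \<otimes> (y \<otimes> g \<otimes> inv y) \<noteq> g \<otimes> k" if "x \<in> H" "y \<in> H" for x y
    using neg that by metis
  have "(?B * ?A) $$ (i, j) = 0"
    unfolding class_sum_mult_index[OF G(1) H R k g i(1) j(1)]
    using neg' conj g k by (auto simp: R_ij intro!: sum.neutral)
  moreover have "(?A * ?B) $$ (i, j) \<noteq> 0"
  proof -
    \<comment> \<open>The coefficient of gk counts the pairs satisfying \<open>P\<close>, all with
      positive sign, and x = y = 1 is one of them.\<close>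
    define P where "P x y \<longleftrightarrow> (x \<otimes> g \<otimes> inv x) \<otimes> (y \<otimes> k \<otimes> inv y) = g \<otimes> k" for x y
    have "(?A * ?B) $$ (i, j) = (\<Sum>x\<in>H. \<Sum>y\<in>H. if P x y then 1 else 0)"
      unfolding class_sum_mult_index[OF G(1) H R g k i(1) j(1)]
      using conj g k by (auto simp: R_ij P_def intro!: sum.cong)
    also have "\<dots> = of_nat (\<Sum>x\<in>H. \<Sum>y\<in>H. if P x y then 1 else 0)"
      unfolding of_nat_sum by (intro sum.cong refl) auto
    finally have eq: "(?A * ?B) $$ (i, j) = of_nat (\<Sum>x\<in>H. \<Sum>y\<in>H. if P x y then 1 else 0)" .
    have one: "\<one> \<in> H" using H by (rule subgroup.one_closed)
    have "P \<one> \<one>" using g k by (simp add: P_def)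
    then have *: "(0::nat) < (\<Sum>y\<in>H. if P \<one> y then 1 else 0)"
      using one finH by (intro sum_pos2[of _ \<one>]) auto
    have "(0::nat) < (\<Sum>x\<in>H. \<Sum>y\<in>H. if P x y then 1 else 0)"
      by (rule sum_pos2[of H \<one>], rule finH, rule one, rule *) simp
    then show ?thesis unfolding eq by (simp del: of_nat_sum)
  qed
  moreover have "(?A * ?B - ?B * ?A) $$ (i, j) = (?A * ?B) $$ (i, j) - (?B * ?A) $$ (i, j)"
    using i j by (subst index_minus_mat) auto
  ultimately have "(?A * ?B - ?B * ?A) $$ (i, j) \<noteq> 0" by simp
  then have C0: "?A * ?B - ?B * ?A \<noteq> 0\<^sub>m N N" by (metis i(1) j(1) index_zero_mat(1))
  have Ac: "?A \<in> carrier_mat N N" and Bc: "?B \<in> carrier_mat N N" by simp_all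
  then have Cc: "?A * ?B \<in> carrier_mat N N" "?B * ?A \<in> carrier_mat N N" by auto
  then have Cc': "?A * ?B - ?B * ?A \<in> carrier_mat N N" by (intro minus_carrier_mat)
  obtain d V \<tau> where V: "V \<in> carrier_mat N d" and \<tau>: "unitary_rep G d \<tau>" "is_irrep G d \<tau>"
    and int: "\<And>x. x \<in> carrier G \<Longrightarrow> R x * V = V * \<tau> x" and CV: "(?A * ?B - ?B * ?A) * V \<noteq> 0\<^sub>m N d"
    by (rule irreducible_constituent[OF G(1) R Cc' C0]) (rule that; assumption)
  let ?a = "class_sum G H d \<tau> g" and ?b = "class_sum G H d \<tau> k"
  have ac: "?a \<in> carrier_mat d d" and bc: "?b \<in> carrier_mat d d" by simp_all
  have comm: "?a * ?b = ?b * ?a"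
    by (rule strong_gelfand_pair_commute[OF G H sg \<tau> ac _ bc])
      (rule class_sum_commute[OF G(1) H \<tau>(1)], rule g k, assumption)+
  have AV: "?A * V = V * ?a" and BV: "?B * V = V * ?b"
    by (rule class_sum_intertwine[OF G(1) H R \<tau>(1) V int], assumption, rule g k)+
  have AB: "?A * ?B * V = V * (?a * ?b)"
  proof -
    have "?A * ?B * V = ?A * (V * ?b)" unfolding assoc_mult_mat[OF Ac Bc V] BV ..
    also have "\<dots> = V * ?a * ?b" unfolding assoc_mult_mat[OF Ac V bc, symmetric] AV ..
    also have "\<dots> = V * (?a * ?b)" by (rule assoc_mult_mat[OF V ac bc])
    finally show ?thesis .
  qed
  have BA: "?B * ?A * V = V * (?b * ?a)"
  proof -
    have "?B * ?A * V = ?B * (V * ?a)" unfolding assoc_mult_mat[OF Bc Ac V] AV ..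
    also have "\<dots> = V * ?b * ?a" unfolding assoc_mult_mat[OF Bc V ac, symmetric] BV ..
    also have "\<dots> = V * (?b * ?a)" by (rule assoc_mult_mat[OF V bc ac])
    finally show ?thesis .
  qed
  have "(?A * ?B - ?B * ?A) * V = V * (?a * ?b) - V * (?a * ?b)"
    unfolding minus_mult_distrib_mat[OF Cc(1,2) V] AB BA comm ..
  also have "\<dots> = 0\<^sub>m N d"
  proof -
    have "V * (?a * ?b) \<in> carrier_mat N d" using V ac bc by auto
    then show ?thesis by (rule minus_r_inv_mat)
  qed
  finally show False using CV by simp
qed

section \<open>Transvections in the symplectic group\<close>

definition sform :: "'a :: comm_ring_1 vec \<Rightarrow> 'a vec \<Rightarrow> 'a" where
  "sform x y = x $ 0 * y $ 2 + x $ 1 * y $ 3 - x $ 2 * y $ 0 - x $ 3 * y $ 1"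

lemma sum_4: "(\<Sum>i = 0..<(4::nat). f i) = f 0 + f 1 + f 2 + (f 3 :: 'b :: comm_monoid_add)"
  by (simp add: numeral_eq_Suc ac_simps)

lemma less_4_cases: "i < (4::nat) \<longleftrightarrow> i = 0 \<or> i = 1 \<or> i = 2 \<or> i = 3"
  by auto

lemma J4_carrier [simp]: "J4 \<in> carrier_mat 4 4"
  by (simp add: J4_def)

lemma dim_J4 [simp]: "dim_row J4 = 4" "dim_col J4 = 4"
  by (simp_all add: J4_def)

lemma J4_mult_vec_carrier [simp]: "J4 *\<^sub>v x \<in> carrier_vec 4"
  by (simp add: carrier_vecI)

lemma sform_eq_J4:
  assumes "x \<in> carrier_vec 4" "y \<in> carrier_vec 4"
  shows "x \<bullet> (J4 *\<^sub>v y) = sform x y"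
  using assms by (simp add: scalar_prod_def sum_4 J4_def sform_def)

text \<open>This translates the matrix equation into preservation of the form, so that closure and
  conjugation can be treated on vectors.\<close>

lemma Sp4_set_iff:
  assumes M: "M \<in> carrier_mat 4 4"
  shows "M \<in> Sp4_set \<longleftrightarrow>
    (\<forall>x\<in>carrier_vec 4. \<forall>y\<in>carrier_vec 4. sform (M *\<^sub>v x) (M *\<^sub>v y) = sform x y)"
proof -
  let ?N = "transpose_mat M * J4 * M"
  have N: "?N \<in> carrier_mat 4 4" using M by auto
  have eq: "x \<bullet> (?N *\<^sub>v y) = sform (M *\<^sub>v x) (M *\<^sub>v y)"
    if x: "x \<in> carrier_vec 4" and y: "y \<in> carrier_vec 4" for x y
  proof -
    have Mt: "transpose_mat M \<in> carrier_mat 4 4" using M by simp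
    have My: "M *\<^sub>v y \<in> carrier_vec 4" "J4 *\<^sub>v (M *\<^sub>v y) \<in> carrier_vec 4" "M *\<^sub>v x \<in> carrier_vec 4"
      using M x y by auto
    have "?N *\<^sub>v y = transpose_mat M * J4 *\<^sub>v (M *\<^sub>v y)"
      using Mt M y by (intro assoc_mult_mat_vec[of _ 4 4 _ 4]) auto
    also have "\<dots> = transpose_mat M *\<^sub>v (J4 *\<^sub>v (M *\<^sub>v y))"
      by (rule assoc_mult_mat_vec[OF Mt J4_carrier My(1)])
    finally have "x \<bullet> (?N *\<^sub>v y) = (transpose_mat M *\<^sub>v (J4 *\<^sub>v (M *\<^sub>v y))) \<bullet> x"
      using Mt x My by (simp add: comm_scalar_prod[of _ 4])
    also have "\<dots> = (J4 *\<^sub>v (M *\<^sub>v y)) \<bullet> (M *\<^sub>v x)"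
      using transpose_vec_mult_scalar[OF M x My(2)] by simp
    also have "\<dots> = (M *\<^sub>v x) \<bullet> (J4 *\<^sub>v (M *\<^sub>v y))"
      by (rule comm_scalar_prod[OF My(2,3)])
    finally show ?thesis using sform_eq_J4[OF My(3,1)] by simp
  qed
  show ?thesis
  proof
    assume "M \<in> Sp4_set"
    then have "?N = J4" by (simp add: Sp4_set_def)
    with eq show "\<forall>x\<in>carrier_vec 4. \<forall>y\<in>carrier_vec 4. sform (M *\<^sub>v x) (M *\<^sub>v y) = sform x y"
      by (metis sform_eq_J4)
  next
    assume *: "\<forall>x\<in>carrier_vec 4. \<forall>y\<in>carrier_vec 4. sform (M *\<^sub>v x) (M *\<^sub>v y) = sform x y"
    have "?N = J4"
    proof (rule eq_mat_by_vec[OF N J4_carrier], rule eq_vecI)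
      fix y :: "'a vec" and i
      assume y: "y \<in> carrier_vec 4" and "i < dim_vec (J4 *\<^sub>v y)"
      then have i: "i < 4" by simp
      have c: "?N *\<^sub>v y \<in> carrier_vec 4" "J4 *\<^sub>v y \<in> carrier_vec 4"
        using N y by auto
      have "unit_vec 4 i \<bullet> (?N *\<^sub>v y) = unit_vec 4 i \<bullet> (J4 *\<^sub>v y)"
        using * eq y by (simp add: sform_eq_J4)
      then show "(?N *\<^sub>v y) $ i = (J4 *\<^sub>v y) $ i"
        unfolding scalar_prod_left_unit[OF c(1) i] scalar_prod_left_unit[OF c(2) i] .
    qed (use M in auto)
    with M show "M \<in> Sp4_set" by (simp add: Sp4_set_def)
  qed
qed

lemma sform_Sp4:
  assumes "M \<in> Sp4_set" "x \<in> carrier_vec 4" "y \<in> carrier_vec 4"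
  shows "sform (M *\<^sub>v x) (M *\<^sub>v y) = sform x y"
  using assms Sp4_set_iff[of M] by (auto simp: Sp4_set_def)

lemma Sp4_set_carrier: "M \<in> Sp4_set \<Longrightarrow> M \<in> carrier_mat 4 4"
  by (simp add: Sp4_set_def)

lemma Sp4_set_mult:
  assumes M: "M \<in> Sp4_set" and N: "N \<in> Sp4_set"
  shows "M * N \<in> Sp4_set"
proof -
  have c: "M \<in> carrier_mat 4 4" "N \<in> carrier_mat 4 4" using M N by (auto simp: Sp4_set_def)
  then have MN: "M * N \<in> carrier_mat 4 4" by auto
  show ?thesis
    unfolding Sp4_set_iff[OF MN]
    using M N c by (auto simp: assoc_mult_mat_vec[OF c] sform_Sp4)
qed

lemma J4_square: "J4 * J4 = - (1\<^sub>m 4 :: 'a :: comm_ring_1 mat)"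
  by (rule eq_matI) (auto simp: J4_def scalar_prod_def sum_4 less_4_cases)

text \<open>Multiplying M^T J M = J by J and using J^2 = -1 yields the inverse. The explicit formula
  also shows that its entries stay in any subfield containing those of \<open>M\<close>.\<close>

lemma Sp4_set_inverse:
  fixes M :: "'a :: field mat"
  assumes M: "M \<in> Sp4_set"
  defines "N \<equiv> - (J4 * (transpose_mat M * J4))"
  shows "N \<in> Sp4_set" "N * M = 1\<^sub>m 4" "M * N = 1\<^sub>m 4"
proof -
  have Mc: "M \<in> carrier_mat 4 4" and eq: "transpose_mat M * J4 * M = J4"
    using M by (auto simp: Sp4_set_def)
  have Nc: "N \<in> carrier_mat 4 4" unfolding N_def using Mc by auto
  have c: "transpose_mat M * J4 \<in> carrier_mat 4 4" "J4 * (transpose_mat M * J4) \<in> carrier_mat 4 4"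
    using Mc by auto
  have "J4 * (transpose_mat M * J4) * M = J4 * J4"
    unfolding assoc_mult_mat[OF J4_carrier c(1) Mc] eq ..
  then have "J4 * (transpose_mat M * J4) * M = - 1\<^sub>m 4" by (simp add: J4_square)
  then show NM: "N * M = 1\<^sub>m 4"
    unfolding N_def using c(2) Mc by (auto simp: uminus_mult_left_mat)
  then show MN: "M * N = 1\<^sub>m 4" by (rule mat_mult_left_right_inverse[OF Nc Mc])
  show "N \<in> Sp4_set"
    unfolding Sp4_set_iff[OF Nc]
  proof (intro ballI)
    fix x y :: "'a vec" assume xy: "x \<in> carrier_vec 4" "y \<in> carrier_vec 4"
    have *: "M *\<^sub>v (N *\<^sub>v v) = v" if "v \<in> carrier_vec 4" for v
      using assoc_mult_mat_vec[OF Mc Nc that] MN that by simp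
    have "sform (M *\<^sub>v (N *\<^sub>v x)) (M *\<^sub>v (N *\<^sub>v y)) = sform (N *\<^sub>v x) (N *\<^sub>v y)"
      using M Nc xy by (intro sform_Sp4) auto
    then show "sform (N *\<^sub>v x) (N *\<^sub>v y) = sform x y" using * xy by simp
  qed
qed

lemma one_in_Sp4_set: "1\<^sub>m 4 \<in> Sp4_set"
  by (simp add: Sp4_set_iff)

lemma group_Sp4: "group (Sp4 TYPE('a :: field))"
proof (rule groupI)
  fix M assume "M \<in> carrier (Sp4 TYPE('a))"
  then have "M \<in> Sp4_set" by (simp add: Sp4_def)
  from Sp4_set_inverse(1,2)[OF this]
  show "\<exists>N\<in>carrier (Sp4 TYPE('a)). N \<otimes>\<^bsub>Sp4 TYPE('a)\<^esub> M = \<one>\<^bsub>Sp4 TYPE('a)\<^esub>"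
    by (auto simp: Sp4_def)
qed (auto simp: Sp4_def Sp4_set_mult one_in_Sp4_set left_mult_one_mat[OF Sp4_set_carrier]
    assoc_mult_mat[OF Sp4_set_carrier Sp4_set_carrier Sp4_set_carrier])

lemma inv_Sp4:
  fixes M N :: "'a :: field mat"
  assumes "M \<in> Sp4_set" "N \<in> Sp4_set" "N * M = 1\<^sub>m 4"
  shows "inv\<^bsub>Sp4 TYPE('a)\<^esub> M = N"
  using assms by (intro group.inv_equality[OF group_Sp4]) (auto simp: Sp4_def)

lemma finite_carrier_mat: "finite (carrier_mat n m :: 'a :: finite mat set)"
proof (rule finite_subset)
  show "finite (mat n m ` (({..<n} \<times> {..<m}) \<rightarrow>\<^sub>E (UNIV :: 'a set)))"
    by (intro finite_imageI finite_PiE) auto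
  show "carrier_mat n m \<subseteq> mat n m ` (({..<n} \<times> {..<m}) \<rightarrow>\<^sub>E (UNIV :: 'a set))"
  proof
    fix M :: "'a mat" assume "M \<in> carrier_mat n m"
    then have eq: "M = mat n m (restrict (\<lambda>p. M $$ p) ({..<n} \<times> {..<m}))"
      by (intro eq_matI) auto
    show "M \<in> mat n m ` (({..<n} \<times> {..<m}) \<rightarrow>\<^sub>E UNIV)" by (rule image_eqI[where f = "mat n m", OF eq]) auto
  qed
qed

lemma finite_Sp4: "finite (carrier (Sp4 TYPE('a :: {finite, field})))"
  by (rule finite_subset[OF _ finite_carrier_mat[of 4 4]]) (auto simp: Sp4_def Sp4_set_def)

section \<open>The subfield subgroup\<close>

context
  fixes F0 :: "'a :: field set"
  assumes F0: "is_subfield F0"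
begin

lemma subfield_simps [simp]: "0 \<in> F0" "1 \<in> F0"
  using F0 by (auto simp: is_subfield_def)

lemma subfield_closed:
  assumes "x \<in> F0" "y \<in> F0"
  shows "x + y \<in> F0" "x - y \<in> F0" "x * y \<in> F0" "x / y \<in> F0"
proof -
  show *: "x + y \<in> F0" "x - y \<in> F0" "x * y \<in> F0"
    using F0 assms by (auto simp: is_subfield_def)
  have "x * inverse y \<in> F0" using F0 assms unfolding is_subfield_def by blast
  then show "x / y \<in> F0" by (simp add: divide_inverse)
qed

lemma subfield_uminus: "x \<in> F0 \<Longrightarrow> - x \<in> F0"
  using subfield_closed(2)[of 0 x] by simp

lemma subfield_sum: "(\<And>i. i \<in> S \<Longrightarrow> f i \<in> F0) \<Longrightarrow> sum f S \<in> F0"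
  by (induction S rule: infinite_finite_induct) (auto intro: subfield_closed)

lemma Sp4_sub_mult_vec:
  assumes "M \<in> Sp4_sub F0" "v \<in> carrier_vec 4" "\<And>i. i < 4 \<Longrightarrow> v $ i \<in> F0" "i < 4"
  shows "(M *\<^sub>v v) $ i \<in> F0"
  using assms by (auto simp: Sp4_sub_def Sp4_set_def scalar_prod_def intro!: subfield_sum subfield_closed)

lemma Sp4_sub_inverse:
  assumes M: "M \<in> Sp4_sub F0"
  obtains N where "N \<in> Sp4_sub F0" "N * M = 1\<^sub>m 4" "M * N = 1\<^sub>m 4"
proof
  let ?N = "- (J4 * (transpose_mat M * J4))"
  have Ms: "M \<in> Sp4_set" and Mc: "M \<in> carrier_mat 4 4" and F: "\<And>i j. i < 4 \<Longrightarrow> j < 4 \<Longrightarrow> M $$ (i, j) \<in> F0"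
    using M by (auto simp: Sp4_sub_def Sp4_set_def)
  show "?N * M = 1\<^sub>m 4" "M * ?N = 1\<^sub>m 4" by (rule Sp4_set_inverse[OF Ms])+
  have "?N $$ (i, j) \<in> F0" if "i < 4" "j < 4" for i j
  proof -
    have J: "J4 $$ (a, b) \<in> F0" if "a < 4" "b < 4" for a b
      using that by (auto simp: J4_def intro: subfield_uminus)
    have MJ: "(transpose_mat M * J4) $$ (a, b) \<in> F0" if "a < 4" "b < 4" for a b
      using that Mc J F by (auto simp: scalar_prod_def intro!: subfield_sum subfield_closed)
    have "(J4 * (transpose_mat M * J4)) $$ (i, j) = (\<Sum>a = 0..<4. J4 $$ (i, a) * (transpose_mat M * J4) $$ (a, j))"
      using that Mc by (subst index_mult_mat) (auto simp: scalar_prod_def)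
    also have "\<dots> \<in> F0" using that J MJ by (intro subfield_sum subfield_closed) auto
    finally show ?thesis using that Mc by (simp add: subfield_uminus)
  qed
  then show "?N \<in> Sp4_sub F0"
    using Sp4_set_inverse(1)[OF Ms] by (simp add: Sp4_sub_def)
qed

lemma subgroup_Sp4_sub: "subgroup (Sp4_sub F0) (Sp4 TYPE('a))"
proof (rule group.subgroupI[OF group_Sp4])
  show "Sp4_sub F0 \<subseteq> carrier (Sp4 TYPE('a))" by (auto simp: Sp4_sub_def Sp4_def)
  show "Sp4_sub F0 \<noteq> {}" using one_in_Sp4_set by (auto simp: Sp4_sub_def intro!: exI[of _ "1\<^sub>m 4"])
  fix M assume M: "M \<in> Sp4_sub F0"
  obtain N where "N \<in> Sp4_sub F0" "N * M = 1\<^sub>m 4" by (rule Sp4_sub_inverse[OF M])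
  moreover from this have "inv\<^bsub>Sp4 TYPE('a)\<^esub> M = N" using M by (intro inv_Sp4) (auto simp: Sp4_sub_def)
  ultimately show "inv\<^bsub>Sp4 TYPE('a)\<^esub> M \<in> Sp4_sub F0" by simp
  fix N assume N: "N \<in> Sp4_sub F0"
  have c: "M \<in> carrier_mat 4 4" "N \<in> carrier_mat 4 4" using M N by (auto simp: Sp4_sub_def Sp4_set_def)
  have "(M * N) $$ (i, j) \<in> F0" if "i < 4" "j < 4" for i j
    using M N c that
    by (auto simp: Sp4_sub_def scalar_prod_def intro!: subfield_sum subfield_closed)
  then show "M \<otimes>\<^bsub>Sp4 TYPE('a)\<^esub> N \<in> Sp4_sub F0"
    using M N by (simp add: Sp4_def Sp4_sub_def Sp4_set_mult)
qed

text \<open>Linear independence of 1 and \<gamma> over \<open>F0\<close>; it splits an equation with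
  one factor \<gamma> into two equations over the subfield.\<close>

lemma subfield_independent:
  assumes "\<gamma> \<notin> F0" "a \<in> F0" "b \<in> F0" "a + \<gamma> * b = 0"
  shows "a = 0 \<and> b = 0"
proof -
  have "b = 0"
  proof (rule ccontr)
    assume b: "b \<noteq> 0"
    have "\<gamma> * b = - a" using assms(4) by (simp add: eq_neg_iff_add_eq_0 add.commute)
    then have "\<gamma> = - a / b" using b by (metis nonzero_mult_div_cancel_right)
    moreover have "- a / b \<in> F0" using assms(2,3) by (intro subfield_closed subfield_uminus)
    ultimately show False using assms(1) by simp
  qed
  then show ?thesis using assms(4) by simp
qed

end

section \<open>Symplectic transvections\<close>

definition transv :: "'a :: comm_ring_1 \<Rightarrow> 'a vec \<Rightarrow> 'a mat" where
  "transv c u = mat 4 4 (\<lambda>(i, j). (if i = j then 1 else 0) + c * sform (unit_vec 4 j) u * u $ i)"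

lemma transv_carrier [simp]: "transv c u \<in> carrier_mat 4 4"
  by (simp add: transv_def)

lemma transv_mult_vec:
  assumes "u \<in> carrier_vec 4" "x \<in> carrier_vec 4"
  shows "transv c u *\<^sub>v x = x + (c * sform x u) \<cdot>\<^sub>v u"
  using assms
  by (intro eq_vecI) (auto simp: transv_def scalar_prod_def sum_4 sform_def less_4_cases algebra_simps)

lemma sform_add_smult:
  assumes "x \<in> carrier_vec 4" "y \<in> carrier_vec 4" "u \<in> carrier_vec 4"
  shows "sform (x + a \<cdot>\<^sub>v u) y = sform x y + a * sform u y"
    and "sform y (x + a \<cdot>\<^sub>v u) = sform y x + a * sform y u"
  using assms by (auto simp: sform_def algebra_simps)

lemma sform_self [simp]: "sform u u = 0"
  by (simp add: sform_def mult.commute)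

lemma sform_flip: "sform u v = - sform v u"
  by (simp add: sform_def mult.commute)

lemma transv_Sp4:
  assumes u: "u \<in> carrier_vec 4"
  shows "transv c u \<in> Sp4_set"
  unfolding Sp4_set_iff[OF transv_carrier]
proof (intro ballI)
  fix x y :: "'a vec" assume xy: "x \<in> carrier_vec 4" "y \<in> carrier_vec 4"
  then show "sform (transv c u *\<^sub>v x) (transv c u *\<^sub>v y) = sform x y"
    using u by (simp add: transv_mult_vec sform_add_smult sform_flip[of u y] algebra_simps)
qed

lemma zero_smult_vec: "v \<in> carrier_vec n \<Longrightarrow> 0 \<cdot>\<^sub>v v = (0\<^sub>v n :: 'a :: comm_ring_1 vec)"
  by (intro eq_vecI) auto

text \<open>Since \<open>M\<close> preserves the form, pairing M^-1 v with u equals pairing v with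
  Mu. Thus the H-conjugates of the two chosen elements are again transvections with the same
  coefficients, and only their axes change.\<close>

lemma transv_conj:
  fixes M N :: "'a :: field mat"
  assumes M: "M \<in> Sp4_set" and N: "N \<in> carrier_mat 4 4" "M * N = 1\<^sub>m 4" and u: "u \<in> carrier_vec 4"
  shows "M * transv c u * N = transv c (M *\<^sub>v u)"
proof (rule eq_mat_by_vec[of _ 4 4])
  have Mc: "M \<in> carrier_mat 4 4" using M by (rule Sp4_set_carrier)
  then show "M * transv c u * N \<in> carrier_mat 4 4" using N by auto
  have Mu: "M *\<^sub>v u \<in> carrier_vec 4" using Mc u by auto
  fix v :: "'a vec" assume v: "v \<in> carrier_vec 4"
  have Nv: "N *\<^sub>v v \<in> carrier_vec 4" using N v by auto
  have MNv: "M *\<^sub>v (N *\<^sub>v v) = v" using assoc_mult_mat_vec[OF Mc N(1) v] N(2) v by simp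
  have MT: "M * transv c u \<in> carrier_mat 4 4" using Mc transv_carrier by (rule mult_carrier_mat)
  have "(M * transv c u * N) *\<^sub>v v = M *\<^sub>v (transv c u *\<^sub>v (N *\<^sub>v v))"
    unfolding assoc_mult_mat_vec[OF MT N(1) v] assoc_mult_mat_vec[OF Mc transv_carrier Nv] ..
  also have "\<dots> = M *\<^sub>v (N *\<^sub>v v) + (c * sform (N *\<^sub>v v) u) \<cdot>\<^sub>v (M *\<^sub>v u)"
    unfolding transv_mult_vec[OF u Nv] using Mc Nv u
    by (simp add: mult_add_distrib_mat_vec[of _ 4 4] mult_mat_vec[of _ 4 4])
  also have "sform (N *\<^sub>v v) u = sform v (M *\<^sub>v u)"
    using sform_Sp4[OF M Nv u] MNv by simp
  finally show "(M * transv c u * N) *\<^sub>v v = transv c (M *\<^sub>v u) *\<^sub>v v"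
    unfolding MNv transv_mult_vec[OF Mu v] .
qed simp

lemma transvections_not_factor:
  fixes F0 :: "'a :: field set"
  assumes F0: "is_subfield F0" and \<gamma>: "\<gamma> \<notin> F0"
    and X: "X \<in> Sp4_sub F0" and Y: "Y \<in> Sp4_sub F0"
  defines "w \<equiv> unit_vec 4 2 + \<gamma> \<cdot>\<^sub>v unit_vec 4 1"
  shows "transv 1 w * transv \<gamma> (unit_vec 4 0) \<noteq> transv \<gamma> (X *\<^sub>v unit_vec 4 0) * transv 1 (Y *\<^sub>v w)"
proof
  let ?e = "unit_vec 4 :: nat \<Rightarrow> 'a vec"
  define u where "u = X *\<^sub>v ?e 0"
  define p where "p = Y *\<^sub>v w"
  assume eq: "transv 1 w * transv \<gamma> (?e 0) = transv \<gamma> (X *\<^sub>v ?e 0) * transv 1 (Y *\<^sub>v w)"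
  have Xs: "X \<in> Sp4_set" "X \<in> carrier_mat 4 4" and Ys: "Y \<in> Sp4_set" "Y \<in> carrier_mat 4 4"
    using X Y by (auto simp: Sp4_sub_def Sp4_set_def)
  have wc [simp]: "w \<in> carrier_vec 4" by (simp add: w_def)
  have uc [simp]: "u \<in> carrier_vec 4" using Xs by (auto simp: u_def)
  have pc [simp]: "p \<in> carrier_vec 4" using Ys by (auto simp: p_def)
  have [simp]: "dim_vec w = 4" "dim_vec u = 4" "dim_vec p = 4"
    by (rule carrier_vecD, simp)+
  have uF: "u $ i \<in> F0" if "i < 4" for i
    unfolding u_def using that F0 X by (intro Sp4_sub_mult_vec) auto
  have act: "transv 1 w *\<^sub>v (transv \<gamma> (?e 0) *\<^sub>v v) = transv \<gamma> u *\<^sub>v (transv 1 p *\<^sub>v v)"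
    if v: "v \<in> carrier_vec 4" for v
    unfolding assoc_mult_mat_vec[OF transv_carrier transv_carrier v, symmetric] eq u_def p_def ..
  obtain Y' where Y': "Y' \<in> Sp4_sub F0" "Y' * Y = 1\<^sub>m 4" by (rule Sp4_sub_inverse[OF F0 Y])
  have Y'c: "Y' \<in> carrier_mat 4 4" using Y'(1) by (auto simp: Sp4_sub_def Sp4_set_def)
  have Y'p: "Y' *\<^sub>v p = w"
    unfolding p_def using assoc_mult_mat_vec[OF Y'c Ys(2) wc] Y'(2) by simp
  \<comment> \<open>Applying the inverse of \<open>Y\<close> turns p into w and keeps u over
    \<open>F0\<close>. A relation with s nonzero would make w proportional to a vector over
    \<open>F0\<close>, whereas the quotient of its coordinates 1 and 2 is \<gamma>.\<close>
  have indep: "s = 0" if z: "s \<cdot>\<^sub>v p + t \<cdot>\<^sub>v u = 0\<^sub>v 4" for s t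
  proof (rule ccontr)
    assume s: "s \<noteq> 0"
    define u' where "u' = Y' *\<^sub>v u"
    have u'c: "u' \<in> carrier_vec 4" using Y'c by (auto simp: u'_def)
    have u'F: "u' $ i \<in> F0" if "i < 4" for i
      unfolding u'_def using that F0 Y'(1) uF by (intro Sp4_sub_mult_vec) auto
    have "s \<cdot>\<^sub>v w + t \<cdot>\<^sub>v u' = Y' *\<^sub>v (s \<cdot>\<^sub>v p + t \<cdot>\<^sub>v u)"
      using Y'c by (simp add: mult_add_distrib_mat_vec[of _ 4 4] mult_mat_vec[of _ 4 4] Y'p u'_def)
    also have "\<dots> = 0\<^sub>v 4" unfolding z using Y'c by simp
    finally have z': "s \<cdot>\<^sub>v w + t \<cdot>\<^sub>v u' = 0\<^sub>v 4" .
    have z1: "s * \<gamma> + t * u' $ 1 = 0" and z2: "s + t * u' $ 2 = 0"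
      using arg_cong[OF z', of "\<lambda>v. v $ 1"] arg_cong[OF z', of "\<lambda>v. v $ 2"] u'c
      by (simp_all add: w_def)
    from z2 s have t: "t \<noteq> 0" and u'2: "u' $ 2 \<noteq> 0" by auto
    have "s = - (t * u' $ 2)" using z2 by (simp add: eq_neg_iff_add_eq_0)
    then have "t * (u' $ 1 - \<gamma> * u' $ 2) = 0"
      using z1 by (simp add: algebra_simps)
    with t have "u' $ 1 + \<gamma> * (- u' $ 2) = 0" by simp
    with subfield_independent[OF F0 \<gamma>, of "u' $ 1" "- u' $ 2"] u'F u'2 subfield_uminus[OF F0]
    show False by simp
  qed
  have u_pair: "sform u (X *\<^sub>v ?e 2) = 1"
    unfolding u_def using Xs by (simp add: sform_Sp4) (simp add: sform_def)
  \<comment> \<open>A vector orthogonal to e_1 and w is fixed by the left side, hence by the right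
    side. Its displacement there is a combination of p and u: \<open>indep\<close> removes the
    p-term, and then u being nonzero forces v to be orthogonal to u.\<close>
  have orth: "sform v u = 0"
    if v: "v \<in> carrier_vec 4" "sform v (?e 0) = 0" "sform v w = 0" for v
  proof -
    have "v = transv \<gamma> u *\<^sub>v (transv 1 p *\<^sub>v v)"
    proof -
      have "transv \<gamma> (?e 0) *\<^sub>v v = v" "transv 1 w *\<^sub>v v = v"
        using v by (simp_all add: transv_mult_vec zero_smult_vec[of _ 4])
      then show ?thesis using act[OF v(1)] by simp
    qed
    also have "\<dots> = v + (sform v p \<cdot>\<^sub>v p + (\<gamma> * (sform v u + sform v p * sform p u)) \<cdot>\<^sub>v u)"
      using v(1) by (simp add: transv_mult_vec sform_add_smult assoc_add_vec[of _ 4])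
    finally have *: "v = v + (sform v p \<cdot>\<^sub>v p + (\<gamma> * (sform v u + sform v p * sform p u)) \<cdot>\<^sub>v u)" .
    have z: "sform v p \<cdot>\<^sub>v p + (\<gamma> * (sform v u + sform v p * sform p u)) \<cdot>\<^sub>v u = 0\<^sub>v 4"
    proof (rule eq_vecI)
      fix i assume "i < dim_vec (0\<^sub>v 4 :: 'a vec)"
      then show "(sform v p \<cdot>\<^sub>v p + (\<gamma> * (sform v u + sform v p * sform p u)) \<cdot>\<^sub>v u) $ i = 0\<^sub>v 4 $ i"
        using arg_cong[OF *, of "\<lambda>x. x $ i"] v(1) by simp
    qed simp
    from indep[OF this] have "sform v p = 0" .
    with z have z': "(\<gamma> * sform v u) \<cdot>\<^sub>v u = 0\<^sub>v 4"
      by (auto simp: vec_eq_iff)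
    show "sform v u = 0"
    proof (rule ccontr)
      assume "sform v u \<noteq> 0"
      moreover have "\<gamma> \<noteq> 0" using \<gamma> subfield_simps[OF F0] by auto
      ultimately have "u $ i = 0" if "i < 4" for i
        using arg_cong[OF z', of "\<lambda>x. x $ i"] that by simp
      then have "sform u (X *\<^sub>v ?e 2) = 0" by (simp add: sform_def)
      with u_pair show False by simp
    qed
  qed
  define a where "a = u $ 0"
  have aF: "a \<in> F0" by (simp add: a_def uF)
  \<comment> \<open>The test vectors e_2 and f_2 + \<gamma> e_1 span the orthogonal complement of
    e_1 and w. The second one gives two coordinates at once, because u is defined over
    \<open>F0\<close>.\<close>
  have u3: "u $ 3 = 0" using orth[of "?e 1"] by (simp add: sform_def w_def)
  have "sform (?e 3 + \<gamma> \<cdot>\<^sub>v ?e 0) u = 0" by (rule orth) (simp_all add: sform_def w_def)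
  then have "- u $ 1 + \<gamma> * u $ 2 = 0" by (simp add: sform_def)
  with subfield_independent[OF F0 \<gamma>, of "- u $ 1" "u $ 2"] uF subfield_uminus[OF F0]
  have u12: "u $ 1 = 0" "u $ 2 = 0" by simp_all
  have u: "u = a \<cdot>\<^sub>v ?e 0"
    using u3 u12 by (intro eq_vecI) (auto simp: a_def less_4_cases)
  have a0: "a \<noteq> 0"
    using u_pair unfolding u by (auto simp: sform_def)
  define s where "s = sform (?e 0) p"
  \<comment> \<open>The next test vector is e_1: the transvection along e_1 fixes it, and the one
    along w moves it by exactly w because the two pair to 1. This expresses w through p and
    u.\<close>
  have "?e 0 + w = transv 1 w *\<^sub>v (transv \<gamma> (?e 0) *\<^sub>v ?e 0)"
  proof -
    have "transv \<gamma> (?e 0) *\<^sub>v ?e 0 = ?e 0" by (simp add: transv_mult_vec zero_smult_vec[of _ 4])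
    moreover have "sform (?e 0) w = 1" by (simp add: sform_def w_def)
    ultimately show ?thesis by (simp add: transv_mult_vec)
  qed
  also have "\<dots> = transv \<gamma> u *\<^sub>v (transv 1 p *\<^sub>v ?e 0)" by (rule act) simp
  also have "\<dots> = ?e 0 + s \<cdot>\<^sub>v p + (\<gamma> * (s * sform p u)) \<cdot>\<^sub>v u"
  proof -
    have "sform (?e 0) u = 0" unfolding u by (simp add: sform_def)
    then show ?thesis by (simp add: transv_mult_vec sform_add_smult s_def)
  qed
  finally have *: "?e 0 + w = ?e 0 + s \<cdot>\<^sub>v p + (\<gamma> * (s * sform p u)) \<cdot>\<^sub>v u" .
  have pu: "sform p u = - a * s"
    unfolding u s_def by (simp add: sform_def)
  have coord: "w $ i = s * p $ i - \<gamma> * (a\<^sup>2 * s\<^sup>2) * ?e 0 $ i" if "i < 4" for i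
  proof -
    have "u $ i = a * ?e 0 $ i" using that by (subst u) simp
    then show ?thesis
      using arg_cong[OF *, of "\<lambda>x. x $ i"] that
      unfolding pu by (simp add: power2_eq_square algebra_simps)
  qed
  \<comment> \<open>At the f_1-coordinate w is 1 and e_1 is 0, and the coordinate of p there is s
    itself.\<close>
  have ss: "s * s = 1"
    using coord[of 2] unfolding s_def sform_def by (simp add: w_def)
  then have s: "s \<in> F0"
    using subfield_uminus[OF F0] subfield_simps[OF F0] by (auto simp: square_eq_1_iff)
  have p_i: "p $ i = Y $$ (i, 2) + \<gamma> * Y $$ (i, 1)" if "i < 4" for i
    using that Ys(2) unfolding p_def w_def
    by (simp add: mult_add_distrib_mat_vec[of _ 4 4] mult_mat_vec[of _ 4 4])
  have YF: "Y $$ (i, j) \<in> F0" if "i < 4" "j < 4" for i j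
    using Y that by (simp add: Sp4_sub_def)
  \<comment> \<open>Columns 2 and 1 of \<open>Y\<close> are the images of f_1 and e_2. The relation
    for w is separated into its parts without and with \<gamma>, which is legitimate because s, a
    and the entries of \<open>Y\<close> lie in \<open>F0\<close>.\<close>
  have split: "s * Y $$ (i, 2) = ?e 2 $ i \<and> s * Y $$ (i, 1) = ?e 1 $ i + a\<^sup>2 * ?e 0 $ i"
    if i: "i < 4" for i
  proof -
    have eF: "?e j $ i \<in> F0" if "j < 4" for j
      using i that subfield_simps[OF F0] by auto
    have "(s * Y $$ (i, 2) - ?e 2 $ i) + \<gamma> * (s * Y $$ (i, 1) - (?e 1 $ i + a\<^sup>2 * ?e 0 $ i)) = 0"
      using coord[OF i] ss i by (simp add: p_i w_def power2_eq_square algebra_simps)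
    moreover have "s * Y $$ (i, 2) - ?e 2 $ i \<in> F0"
      "s * Y $$ (i, 1) - (?e 1 $ i + a\<^sup>2 * ?e 0 $ i) \<in> F0"
      unfolding power2_eq_square
      using s aF i by (auto intro!: subfield_closed[OF F0] YF eF simp del: index_unit_vec)
    ultimately show ?thesis using subfield_independent[OF F0 \<gamma>] by fastforce
  qed
  have "sform (Y *\<^sub>v ?e 2) (Y *\<^sub>v ?e 1) = 0"
    using Ys by (simp add: sform_Sp4) (simp add: sform_def)
  moreover have "(s * s) * sform (Y *\<^sub>v ?e 2) (Y *\<^sub>v ?e 1) = - a\<^sup>2"
  proof -
    \<comment> \<open>One factor s goes to each column, so that the values in \<open>split\<close>
      apply. The entries of column 1 in rows 1, 2 and 3 meet vanishing entries of column 2; only the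
      product of 1 and a^2 survives.\<close>
    have "(s * s) * sform (Y *\<^sub>v ?e 2) (Y *\<^sub>v ?e 1) =
      (s * Y $$ (0, 2)) * (s * Y $$ (2, 1)) + (s * Y $$ (1, 2)) * (s * Y $$ (3, 1))
      - (s * Y $$ (2, 2)) * (s * Y $$ (0, 1)) - (s * Y $$ (3, 2)) * (s * Y $$ (1, 1))"
      using Ys(2) by (simp add: sform_def algebra_simps)
    also have "\<dots> = - a\<^sup>2"
    proof -
      have *: "s * Y $$ (0, 2) = 0" "s * Y $$ (1, 2) = 0" "s * Y $$ (2, 2) = 1"
        "s * Y $$ (3, 2) = 0" "s * Y $$ (0, 1) = a\<^sup>2"
        using split[of 0] split[of 1] split[of 2] split[of 3] by simp_all
      show ?thesis unfolding * by simp
    qed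
    finally show ?thesis .
  qed
  ultimately show False using a0 by simp
qed

text \<open>\<open>F0\<close> contains 0 and 1, so it has at least two elements, and a power with
  exponent above 1 is strictly larger.\<close>

lemma proper_subfield:
  fixes F0 :: "'a :: {field, finite} set"
  assumes "is_subfield F0" "prime (r :: nat)" "card (UNIV :: 'a set) = card F0 ^ r"
  shows "F0 \<noteq> UNIV"
proof
  assume UNIV: "F0 = UNIV"
  have "{0, 1} \<subseteq> F0" using subfield_simps[OF assms(1)] by blast
  then have "card {0, 1 :: 'a} \<le> card F0" by (intro card_mono) simp_all
  then have "1 < card F0" by simp
  from power_strict_increasing[OF prime_gt_1_nat[OF assms(2)] this]
  show False using assms(3) unfolding UNIV by simp
qed

theorem theorem5p4:
  fixes F0 :: "'a :: {field, finite} set"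
    and e r :: nat
  assumes "card (UNIV :: 'a set) = 2 ^ e" and "e > 1"
    and "is_subfield F0"
    and "prime r" and "card (UNIV :: 'a set) = card F0 ^ r"
  shows "\<not> strong_gelfand_pair (Sp4 TYPE('a)) (Sp4_sub F0)"
proof
  let ?G = "Sp4 TYPE('a)"
  assume sg: "strong_gelfand_pair ?G (Sp4_sub F0)"
  note F0 = assms(3)
  obtain \<gamma> where \<gamma>: "\<gamma> \<notin> F0" using proper_subfield[OF F0 assms(4,5)] by blast
  define w where "w = unit_vec 4 2 + \<gamma> \<cdot>\<^sub>v unit_vec 4 1"
  have w: "w \<in> carrier_vec 4" by (simp add: w_def)
  have car: "transv c u \<in> carrier ?G" if "u \<in> carrier_vec 4" for c u
    using transv_Sp4[OF that] by (simp add: Sp4_def)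
  have conj: "X \<otimes>\<^bsub>?G\<^esub> transv c u \<otimes>\<^bsub>?G\<^esub> inv\<^bsub>?G\<^esub> X = transv c (X *\<^sub>v u)"
    if X: "X \<in> Sp4_sub F0" and u: "u \<in> carrier_vec 4" for X c u
  proof -
    obtain N where N: "N \<in> Sp4_sub F0" "N * X = 1\<^sub>m 4" "X * N = 1\<^sub>m 4"
      by (rule Sp4_sub_inverse[OF F0 X])
    have XN: "X \<in> Sp4_set" "N \<in> Sp4_set" using X N(1) by (simp_all add: Sp4_sub_def)
    have "inv\<^bsub>?G\<^esub> X = N" by (rule inv_Sp4[OF XN N(2)])
    then show ?thesis
      using transv_conj[OF XN(1) Sp4_set_carrier[OF XN(2)] N(3) u] by (simp add: Sp4_def)
  qed
  obtain X Y where X: "X \<in> Sp4_sub F0" and Y: "Y \<in> Sp4_sub F0"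
    and eq: "transv 1 w \<otimes>\<^bsub>?G\<^esub> transv \<gamma> (unit_vec 4 0) =
      (X \<otimes>\<^bsub>?G\<^esub> transv \<gamma> (unit_vec 4 0) \<otimes>\<^bsub>?G\<^esub> inv\<^bsub>?G\<^esub> X) \<otimes>\<^bsub>?G\<^esub>
      (Y \<otimes>\<^bsub>?G\<^esub> transv 1 w \<otimes>\<^bsub>?G\<^esub> inv\<^bsub>?G\<^esub> Y)"
    using strong_gelfand_pair_factor[OF group_Sp4 finite_Sp4 subgroup_Sp4_sub[OF F0] sg
        car[OF w] car[OF unit_vec_carrier]] by blast
  have "transv 1 w * transv \<gamma> (unit_vec 4 0) = transv \<gamma> (X *\<^sub>v unit_vec 4 0) * transv 1 (Y *\<^sub>v w)"
    using eq unfolding conj[OF X unit_vec_carrier] conj[OF Y w] by (simp add: Sp4_def)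
  with transvections_not_factor[OF F0 \<gamma> X Y] show False unfolding w_def by contradiction
qed

end
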